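(* Let $\mathcal{H}$ be a real Hilbert space, let $f:\mathcal{H}\to\mathbb{R}\cup\{+\infty\}$ be proper, convex and lower semicontinuous, and let $g:\mathcal{H}\to\mathbb{R}$ be convex and continuously Fréchet differentiable with $L$-Lipschitz continuous gradient ($L>0$). Assume $\operatorname{argmin}(f+g)\neq\emptyset$. Let $0<s<\frac1L$, $\frac12\le q\le 1$, $0<a\le\frac{1}{2q}$, $c>0$, $p>0$, and put $\varepsilon_k=\frac{c}{k^p}$ for $k\ge1$. Let $x_0,x_1\in\mathcal{H}$ be arbitrary and for all $k\ge 1$ set $$y_k= x_k+\frac{((ak+1)^q-1)((ak+1-a)^q-1)}{(ak+1-a)^{2q}}(x_k-x_{k-1})-\frac{-(ak+1)^{2q}+(ak+1)^q+(ak+1-a)^{2q}}{(ak+1-a)^{2q}(ak+1)^{q}}\, x_k,$$ $$x_{k+1}=\operatorname{prox}_{sf}\left(y_k-s\nabla g(y_k)-s\frac{c}{k^p}\, y_k\right).$$ (i) If $\frac12\le q<1$ and $p<2q$, then $(x_k)$ converges strongly to $x^*$, the minimum norm minimizer of $f+g$, i.e. $\{x^*\}=\operatorname{pr}_{\operatorname{argmin}(f+g)}(0)$. Moreover $\|x_k-y_k\|=o(\sqrt{\varepsilon_k})$ as $k\to+\infty$, hence $(y_k)$ also converges strongly to $x^*$. Further, as $k\to+\infty$, $$(f+g)(x_k)-\min(f+g)=\mathcal{O}(k^{-p}),\qquad \|x_k-x_{k-1}\|=o\left(k^{-\frac p2}\right),$$ and there exist $u_k\in\partial f(x_k)+\nabla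 g(x_k)$ ($k\ge2$) such that $\|u_k\|=o\left(k^{-\frac p2}\right)$. (ii) If $\frac12\le q\le1$ and $p\ge 2q$, and if moreover $p>2$ in the case $a=\frac12,\ q=1$, then $$(f+g)(x_k)-\min(f+g)=\mathcal{O}(k^{-2q})\quad\text{as }k\to+\infty.$$
   Context: For $s>0$, $\operatorname{prox}_{sf}(x)=\operatorname{argmin}_{y\in\mathcal{H}}\left\{f(y)+\frac{1}{2s}\|y-x\|^2\right\}$. $\partial f$ is the convex subdifferential. $\operatorname{pr}_C(0)$ denotes the metric projection of $0$ onto the nonempty closed convex set $C$, i.e. the element of $C$ of minimal norm. *)

theory Defs
  imports "HOL-Analysis.Analysis" "HOL-Library.Landau_Symbols"
begin

text \<open>
  Functions \<open>\<H> \<rightarrow> \<real> \<union> {+\<infinity>}\<close> are total functions into \<^typ>\<open>ereal\<close>; the value \<open>-\<infinity>\<close> is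
  excluded by properness.
\<close>

definition proper_fun :: "('a \<Rightarrow> ereal) \<Rightarrow> bool" where
  "proper_fun f \<longleftrightarrow> (\<forall>x. f x \<noteq> -\<infinity>) \<and> (\<exists>x. f x \<noteq> \<infinity>)"

text \<open>
  For \<open>t = 0\<close> or \<open>t = 1\<close> the product \<open>0 * \<infinity> = 0\<close> of \<^typ>\<open>ereal\<close> makes the inequality trivial;
  for proper \<open>f\<close> the right-hand side never has the form \<open>\<infinity> - \<infinity>\<close>.
\<close>

definition convex_fun :: "('a::real_vector \<Rightarrow> ereal) \<Rightarrow> bool" where
  "convex_fun f \<longleftrightarrow>
     (\<forall>x y. \<forall>t\<in>{0..1::real}.
        f ((1 - t) *\<^sub>R x + t *\<^sub>R y) \<le> ereal (1 - t) * f x + ereal t * f y)"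

definition lsc_fun :: "('a::topological_space \<Rightarrow> ereal) \<Rightarrow> bool" where
  "lsc_fun f \<longleftrightarrow> (\<forall>x. f x \<le> Liminf (at x) f)"

definition argmin_set :: "('a \<Rightarrow> ereal) \<Rightarrow> 'a set" where
  "argmin_set h = {x. is_arg_min h (\<lambda>_. True) x}"

text \<open>
  \<^const>\<open>arg_min\<close> chooses a minimizer; for proper convex lower semicontinuous \<open>f\<close> on a Hilbert
  space and \<open>s > 0\<close> there is exactly one.
\<close>

definition prox :: "real \<Rightarrow> ('a::real_inner \<Rightarrow> ereal) \<Rightarrow> 'a \<Rightarrow> 'a" where
  "prox s f x = arg_min (\<lambda>y. f y + ereal (1 / (2 * s) * (norm (y - x))\<^sup>2)) (\<lambda>_. True)"

definition subdiff :: "('a::real_inner \<Rightarrow> ereal) \<Rightarrow> 'a \<Rightarrow> 'a set" where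
  "subdiff f x = {u. \<bar>f x\<bar> \<noteq> \<infinity> \<and> (\<forall>z. f x + ereal (inner u (z - x)) \<le> f z)}"

text \<open>
  The set of all best approximations, a singleton if \<open>C\<close> is nonempty, closed and convex.  The
  library's \<^const>\<open>closest_point\<close> is confined to Heine-Borel (finite-dimensional) spaces.
\<close>

definition metric_proj :: "'a::metric_space set \<Rightarrow> 'a \<Rightarrow> 'a set" where
  "metric_proj C x = {z \<in> C. \<forall>w\<in>C. dist x z \<le> dist x w}"

definition fsum :: "('a \<Rightarrow> ereal) \<Rightarrow> ('a \<Rightarrow> real) \<Rightarrow> 'a \<Rightarrow> ereal" where
  "fsum f g = (\<lambda>x. f x + ereal (g x))"

text \<open>
  \<open>h (x\<^sub>k) - min h = O(r\<^sub>k)\<close> for an extended-real-valued \<open>h\<close> with a finite minimum.  Since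
  \<^const>\<open>real_of_ereal\<close> maps \<open>\<infinity>\<close> to \<open>0\<close>, eventual finiteness of \<open>h (x\<^sub>k)\<close>, implicit in an
  \<open>O\<close>-estimate, has to be stated.
\<close>

definition gap_bigo :: "('a \<Rightarrow> ereal) \<Rightarrow> (nat \<Rightarrow> 'a) \<Rightarrow> (nat \<Rightarrow> real) \<Rightarrow> bool" where
  "gap_bigo h x r \<longleftrightarrow>
     (\<forall>\<^sub>F k in sequentially. \<bar>h (x k)\<bar> \<noteq> \<infinity>) \<and>
     (\<lambda>k. real_of_ereal (h (x k) - (INF z. h z))) \<in> O(r)"

end

theory Submission
  imports Defs "HOL-Real_Asymp.Real_Asymp"
begin

text \<open>
  Write \<open>t\<^sub>k = (a (k - 1) + 1) powr q\<close>, \<open>z\<^sub>k = x\<^sub>k\<^sub>-\<^sub>1 + t\<^sub>k (x\<^sub>k - x\<^sub>k\<^sub>-\<^sub>1)\<close> and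
  \<open>\<theta>\<^sub>k = (t\<^sub>k\<^sub>+\<^sub>1\<^sup>2 - t\<^sub>k\<^sub>+\<^sub>1) / t\<^sub>k\<^sup>2\<close>, which lies in \<open>[0, 1]\<close> because \<open>a \<le> 1 / (2 q)\<close>.  The extrapolation
  is \<open>y\<^sub>k = (1 - 1 / t\<^sub>k\<^sub>+\<^sub>1) x\<^sub>k + (1 / t\<^sub>k\<^sub>+\<^sub>1) \<theta>\<^sub>k z\<^sub>k\<close>: a Nesterov step whose momentum point is
  shrunk towards \<open>0\<close>.  The step to \<open>x\<^sub>k\<^sub>+\<^sub>1\<close> is a proximal gradient step for
  \<open>F\<^sub>k = f + g + \<epsilon>\<^sub>k / 2 \<parallel>\<cdot>\<parallel>\<^sup>2\<close>.  Comparing it with the point \<open>(1 - 1 / t\<^sub>k\<^sub>+\<^sub>1) x\<^sub>k + (1 / t\<^sub>k\<^sub>+\<^sub>1) w\<close> for a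
  fixed minimizer \<open>w\<close> shows that the energy
  \<open>E\<^sub>k = t\<^sub>k\<^sup>2 (F\<^sub>k\<^sub>-\<^sub>1 x\<^sub>k - F\<^sub>k\<^sub>-\<^sub>1 w) + \<parallel>z\<^sub>k - w\<parallel>\<^sup>2 / (2 s)\<close> satisfies
  \<open>E\<^sub>k\<^sub>+\<^sub>1 \<le> \<theta>\<^sub>k E\<^sub>k + \<parallel>w\<parallel>\<^sup>2 (t\<^sub>k\<^sub>+\<^sub>1\<^sup>2 (\<epsilon>\<^sub>k\<^sub>-\<^sub>1 - \<epsilon>\<^sub>k) / 2 + (1 - \<theta>\<^sub>k) / (2 s))\<close>.

  For \<open>p \<ge> 2 q\<close> the perturbation is absorbed by the contraction, or is summable if \<open>a = 1 / 2\<close> and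
  \<open>q = 1\<close>, so \<open>E\<close> is bounded.  For \<open>p < 2 q\<close> and \<open>q < 1\<close> it is \<open>o (t\<^sub>k\<^sub>+\<^sub>1 \<epsilon>\<^sub>k)\<close>, which gives
  \<open>E\<^sub>k \<le> \<eta> t\<^sub>k\<^sup>2 \<epsilon>\<^sub>k\<^sub>-\<^sub>1\<close> eventually, for every \<open>\<eta> > 0\<close>.  Taking for \<open>w\<close> the minimizer of least norm,
  the infima of \<open>2 (f + g - min) / \<epsilon>\<^sub>k + \<parallel>\<cdot>\<parallel>\<^sup>2\<close> increase to \<open>\<parallel>w\<parallel>\<^sup>2\<close>; hence \<open>x\<^sub>k\<close> nearly minimizes
  these functions, and their strong convexity turns this into strong convergence to \<open>w\<close>, without
  any weak compactness.
\<close>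

section \<open>Convexity in Hilbert space\<close>

lemma GDERIV_along_line:
  fixes g :: "'a::real_inner \<Rightarrow> real"
  assumes "\<And>z. GDERIV g z :> G z"
  shows "((\<lambda>r. g (y + r *\<^sub>R d)) has_real_derivative inner (G (y + r *\<^sub>R d)) d) (at r)"
proof -
  have g': "(g has_derivative (\<lambda>h. inner h (G (y + r *\<^sub>R d)))) (at (y + r *\<^sub>R d))"
    using assms gderiv_def by blast
  have l: "((\<lambda>r. y + r *\<^sub>R d) has_derivative (\<lambda>h. h *\<^sub>R d)) (at r)"
    by (auto intro!: derivative_eq_intros)
  have "((\<lambda>r. g (y + r *\<^sub>R d)) has_derivative (\<lambda>h. inner (h *\<^sub>R d) (G (y + r *\<^sub>R d)))) (at r)"
    using has_derivative_compose[OF l g'] .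
  moreover have "(\<lambda>h. inner (h *\<^sub>R d) (G (y + r *\<^sub>R d))) = (*) (inner (G (y + r *\<^sub>R d)) d)"
    by (auto simp: inner_commute mult.commute)
  ultimately show ?thesis
    unfolding has_field_derivative_def by simp
qed

text \<open>Restricting \<open>g\<close> to the line through \<open>y\<close> and \<open>z\<close>
  leaves the tangent inequality for a convex function of one real variable, between the parameters 0
  and 1.\<close>

lemma convex_ge_tangent:
  fixes g :: "'a::real_inner \<Rightarrow> real"
  assumes cg: "convex_on UNIV g" and G: "\<And>z. GDERIV g z :> G z"
  shows "g y + inner (G y) (z - y) \<le> g z"
proof -
  have "convex_on UNIV (\<lambda>r. g (y + r *\<^sub>R (z - y)))"
  proof (rule convex_onI)
    fix t u v :: real assume t: "0 < t" "t < 1"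
    have "y + ((1 - t) *\<^sub>R u + t *\<^sub>R v) *\<^sub>R (z - y)
        = (1 - t) *\<^sub>R (y + u *\<^sub>R (z - y)) + t *\<^sub>R (y + v *\<^sub>R (z - y))"
      by (simp add: algebra_simps)
    then show "g (y + ((1 - t) *\<^sub>R u + t *\<^sub>R v) *\<^sub>R (z - y))
       \<le> (1 - t) * g (y + u *\<^sub>R (z - y)) + t * g (y + v *\<^sub>R (z - y))"
      using convex_onD[OF cg, of t] t by simp
  qed simp
  from convex_on_imp_above_tangent[OF this, where c = 0 and x = 1 and f' = "inner (G y) (z - y)"]
    GDERIV_along_line[OF G, of y "z - y" 0]
  show ?thesis by simp
qed

lemma descent_lemma:
  fixes g :: "'a::real_inner \<Rightarrow> real"
  assumes G: "\<And>z. GDERIV g z :> G z" and lip: "L-lipschitz_on UNIV G"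
  shows "g z \<le> g y + inner (G y) (z - y) + L / 2 * (norm (z - y))\<^sup>2"
proof -
  define d where "d = z - y"
  \<comment> \<open>\<open>h\<close> is \<open>g\<close> along the segment minus the linear and
    quadratic parts of the claimed bound; the Lipschitz estimate makes its derivative nonpositive,
    and \<open>h 1 \<le> h 0\<close> is the claim.\<close>
  define h where "h r = g (y + r *\<^sub>R d) - r * inner (G y) d - L / 2 * r\<^sup>2 * (norm d)\<^sup>2" for r
  have "h 1 \<le> h 0"
  proof (rule DERIV_nonpos_imp_nonincreasing[of 0 1 h])
    fix r :: real assume r: "0 \<le> r" "r \<le> 1"
    have "(h has_real_derivative inner (G (y + r *\<^sub>R d)) d - inner (G y) d - L * r * (norm d)\<^sup>2) (at r)"
      unfolding h_def
      by (rule derivative_eq_intros GDERIV_along_line[OF G] refl | simp)+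
    moreover have "inner (G (y + r *\<^sub>R d)) d - inner (G y) d - L * r * (norm d)\<^sup>2 \<le> 0"
    proof -
      have "inner (G (y + r *\<^sub>R d)) d - inner (G y) d = inner (G (y + r *\<^sub>R d) - G y) d"
        by (simp add: inner_diff_left)
      also have "\<dots> \<le> norm (G (y + r *\<^sub>R d) - G y) * norm d"
        by (rule norm_cauchy_schwarz)
      also have "\<dots> \<le> (L * norm (r *\<^sub>R d)) * norm d"
        using lipschitz_onD[OF lip, of "y + r *\<^sub>R d" y]
        by (intro mult_right_mono) (auto simp: dist_norm)
      finally show ?thesis using r by (simp add: power2_eq_square mult_ac)
    qed
    ultimately show "\<exists>y. DERIV h r :> y \<and> y \<le> 0" by blast
  qed simp
  then show ?thesis by (simp add: h_def d_def)
qed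

text \<open>First-order optimality: moving from \<open>p\<close> a fraction \<open>l\<close> towards
  \<open>z\<close> costs only \<open>l\<^sup>2 * N\<close> beyond first order, so dividing by
  \<open>l\<close> and letting \<open>l\<close> tend to 0 removes the error. Applied below with
  \<open>\<psi> = g\<close> and with \<open>\<psi>\<close> the proximal quadratic.\<close>

lemma minimizer_subgradient:
  fixes \<phi> \<psi> :: "'a::real_inner \<Rightarrow> real"
  assumes conv: "convex_on D \<phi>" and p: "p \<in> D"
    and min: "\<And>z. z \<in> D \<Longrightarrow> \<phi> p + \<psi> p \<le> \<phi> z + \<psi> z"
    and upper: "\<And>z. \<psi> z \<le> \<psi> p + inner G (z - p) + K * (norm (z - p))\<^sup>2"
    and z: "z \<in> D"
  shows "\<phi> p - inner G (z - p) \<le> \<phi> z"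
proof -
  define N where "N = K * (norm (z - p))\<^sup>2"
  have le: "\<phi> p - inner G (z - p) \<le> \<phi> z + l * N" if l: "0 < l" "l < 1" for l
  proof -
    define v where "v = (1 - l) *\<^sub>R p + l *\<^sub>R z"
    have v: "v \<in> D"
      using convex_on_imp_convex[OF conv] p z l unfolding v_def convex_alt by auto
    have vp: "v - p = l *\<^sub>R (z - p)" by (simp add: v_def algebra_simps)
    have "\<phi> p + \<psi> p \<le> \<phi> v + \<psi> v" using min[OF v] .
    moreover have "\<phi> v \<le> (1 - l) * \<phi> p + l * \<phi> z"
      unfolding v_def using convex_onD[OF conv, of l p z] l p z by simp
    moreover have "\<psi> v \<le> \<psi> p + l * inner G (z - p) + l\<^sup>2 * N"
      using upper[of v] l unfolding vp N_def by (simp add: power_mult_distrib mult_ac)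
    ultimately have "l * (\<phi> p - inner G (z - p)) \<le> l * (\<phi> z + l * N)"
      by (simp add: algebra_simps power2_eq_square)
    then show ?thesis using l by simp
  qed
  have "((\<lambda>l. \<phi> z + l * N) \<longlongrightarrow> \<phi> z + 0 * N) (at_right 0)"
    by (intro tendsto_intros)
  moreover have "\<forall>\<^sub>F l in at_right (0::real). \<phi> p - inner G (z - p) \<le> \<phi> z + l * N"
    unfolding eventually_at_right[OF zero_less_one] using le by (intro exI[of _ 1]) simp
  ultimately show ?thesis
    using tendsto_lowerbound[of "\<lambda>l. \<phi> z + l * N" "\<phi> z" "at_right 0"] by simp
qed

text \<open>The parallelogram law at the midpoint: points at which \<open>h\<close> plus the squared
  distance to \<open>u\<close> is close to the lower bound \<open>m\<close> are close to each
  other.\<close>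

lemma convex_plus_norm_midpoint:
  fixes u :: "'a::real_inner"
  assumes h: "convex_on D h" and v: "v \<in> D" and w: "w \<in> D"
    and m: "\<And>z. z \<in> D \<Longrightarrow> m \<le> h z + (norm (z - u))\<^sup>2"
  shows "(norm (v - w))\<^sup>2 \<le> 2 * (h v + (norm (v - u))\<^sup>2) + 2 * (h w + (norm (w - u))\<^sup>2) - 4 * m"
proof -
  define c where "c = (1/2) *\<^sub>R v + (1/2) *\<^sub>R w"
  have c: "c \<in> D"
    unfolding c_def using convexD[OF convex_on_imp_convex[OF h] v w, of "1/2" "1/2"] by simp
  have "h c \<le> h v / 2 + h w / 2"
    unfolding c_def using convex_onD[OF h, of "1/2" v w] v w by simp
  moreover have "4 * (norm (c - u))\<^sup>2 = 2 * (norm (v - u))\<^sup>2 + 2 * (norm (w - u))\<^sup>2 - (norm (v - w))\<^sup>2"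
  proof -
    have "c - u = (1/2) *\<^sub>R ((v - u) + (w - u))"
      unfolding c_def by (simp add: algebra_simps flip: scaleR_add_left)
    then have "4 * (norm (c - u))\<^sup>2 = (norm ((v - u) + (w - u)))\<^sup>2"
      by (simp add: power_divide)
    also have "\<dots> = 2 * (norm (v - u))\<^sup>2 + 2 * (norm (w - u))\<^sup>2 - (norm ((v - u) - (w - u)))\<^sup>2"
      by (simp only: power2_norm_eq_inner inner_diff_left inner_diff_right inner_add_left inner_add_right)
        (simp add: inner_commute)
    finally show ?thesis by simp
  qed
  ultimately show ?thesis using m[OF c] by argo
qed

text \<open>
  A constant sequence \<open>h\<close> yields the proximal point of \<open>u\<close>; with \<open>u = 0\<close> and multiples of
  \<open>f + g - min\<close> tending to infinity one gets the minimizer of least norm.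
\<close>

lemma strongly_convex_incseq_min:
  fixes h :: "nat \<Rightarrow> 'a::{real_inner, complete_space} \<Rightarrow> real"
  assumes conv: "\<And>k. convex_on D (h k)" and ne: "D \<noteq> {}"
    and cl: "\<And>k b. closed {v \<in> D. h k v \<le> b}"
    and mono: "\<And>j k v. v \<in> D \<Longrightarrow> j \<le> k \<Longrightarrow> h j v \<le> h k v"
    and lower: "\<And>v. v \<in> D \<Longrightarrow> B \<le> h 0 v + (norm (v - u))\<^sup>2"
    and w: "w \<in> D" and upper: "\<And>k. h k w \<le> C"
  obtains v m M where "v \<in> D" and "m \<longlonglongrightarrow> M"
    and "\<And>k z. z \<in> D \<Longrightarrow> m k \<le> h k z + (norm (z - u))\<^sup>2"
    and "\<And>k. h k v + (norm (v - u))\<^sup>2 \<le> M"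
proof -
  define H where "H k v = h k v + (norm (v - u))\<^sup>2" for k v
  define m where "m k = (INF v\<in>D. H k v)" for k
  have bdd: "bdd_below (H k ` D)" for k
    using lower mono[of _ 0 k] by (intro bdd_belowI[of _ B]) (force simp: H_def)
  have m_le: "m k \<le> H k z" if "z \<in> D" for k z
    unfolding m_def by (rule cINF_lower[OF bdd that])
  have m_great: "b \<le> m k" if "\<And>z. z \<in> D \<Longrightarrow> b \<le> H k z" for k b
    unfolding m_def by (rule cINF_greatest[OF ne that])
  have incm: "incseq m"
  proof (rule incseq_SucI, rule m_great)
    fix k z assume z: "z \<in> D"
    show "m k \<le> H (Suc k) z"
      using m_le[OF z, of k] mono[OF z, of k "Suc k"] by (simp add: H_def)
  qed
  have "m k \<le> C + (norm (w - u))\<^sup>2" for k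
    using m_le[OF w, of k] upper[of k] by (simp add: H_def)
  then obtain M where mM: "m \<longlonglongrightarrow> M" and mleM: "\<And>k. m k \<le> M"
    using incseq_convergent[OF incm] by blast
  have "\<exists>v\<in>D. H k v < m k + 1 / real (Suc k)" for k
    using m_great[of "m k + 1 / real (Suc k)" k] by (force simp: not_less)
  then obtain V where V: "\<And>k. V k \<in> D" "\<And>k. H k (V k) < m k + 1 / real (Suc k)"
    by metis
  have HkVj: "H k (V j) \<le> m j + 1 / real (Suc j)" if "k \<le> j" for j k
    using mono[OF V(1), of k j j] that V(2)[of j] by (simp add: H_def)
  \<comment> \<open>For \<open>j \<ge> k\<close> both \<open>V k\<close> and \<open>V j\<close>
    nearly minimize \<open>H k\<close>, since \<open>H k \<le> H j\<close> on \<open>D\<close> and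
    \<open>m j \<le> M\<close>. The midpoint estimate at level \<open>k\<close> then bounds their
    distance independently of \<open>j\<close>.\<close>
  have close: "(norm (V k - V j))\<^sup>2 \<le> 2 * (M - m k) + 4 / real (Suc k)" if kj: "k \<le> j" for j k
  proof -
    have "(norm (V k - V j))\<^sup>2 \<le> 2 * H k (V k) + 2 * H k (V j) - 4 * m k"
      unfolding H_def
      by (rule convex_plus_norm_midpoint[OF conv V(1) V(1)]) (use m_le in \<open>simp add: H_def\<close>)
    moreover have "1 / real (Suc j) \<le> 1 / real (Suc k)"
      using kj by (simp add: frac_le)
    ultimately show ?thesis
      using HkVj[OF kj] V(2)[of k] mleM[of j] by simp
  qed
  have "(\<lambda>k. 2 * (M - m k) + 4 / real (Suc k)) \<longlonglongrightarrow> 2 * (M - M) + 0"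
    by (intro tendsto_intros mM) real_asymp
  then have lim0: "(\<lambda>k. 2 * (M - m k) + 4 / real (Suc k)) \<longlonglongrightarrow> 0" by simp
  have "Cauchy V"
    unfolding Cauchy_altdef
  proof (intro allI impI)
    fix e :: real assume e: "e > 0"
    then have "\<forall>\<^sub>F k in sequentially. 2 * (M - m k) + 4 / real (Suc k) < e\<^sup>2"
      by (intro order_tendstoD(2)[OF lim0]) simp
    then obtain N where N: "\<And>k. k \<ge> N \<Longrightarrow> 2 * (M - m k) + 4 / real (Suc k) < e\<^sup>2"
      by (auto simp: eventually_sequentially)
    show "\<exists>N. \<forall>k\<ge>N. \<forall>j>k. dist (V k) (V j) < e"
    proof (intro exI allI impI)
      fix k j assume "N \<le> k" "k < j"
      then have "(norm (V k - V j))\<^sup>2 < e\<^sup>2"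
        using close[of k j] N[of k] by simp
      then show "dist (V k) (V j) < e"
        using e power2_less_imp_less[of "norm (V k - V j)" e] by (simp add: dist_norm)
    qed
  qed
  then obtain v where v: "V \<longlonglongrightarrow> v"
    using Cauchy_convergent_iff convergent_def by blast
  \<comment> \<open>Closedness is given for sublevel sets of \<open>h k\<close>, not of
    \<open>H k\<close>, so the convergent norm term is moved into the level; the slack
    \<open>d\<close> makes that level independent of \<open>j\<close>.\<close>
  have vk: "v \<in> D \<and> h k v \<le> M - (norm (v - u))\<^sup>2 + d" if d: "d > 0" for k d
  proof -
    have "(\<lambda>j. M + 1 / real (Suc j) - (norm (V j - u))\<^sup>2) \<longlonglongrightarrow> M + 0 - (norm (v - u))\<^sup>2"
      by (intro tendsto_intros v) real_asymp
    then have "\<forall>\<^sub>F j in sequentially. M + 1 / real (Suc j) - (norm (V j - u))\<^sup>2 < M - (norm (v - u))\<^sup>2 + d"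
      by (rule order_tendstoD(2)) (use d in simp)
    then have "\<forall>\<^sub>F j in sequentially. V j \<in> {z \<in> D. h k z \<le> M - (norm (v - u))\<^sup>2 + d}"
      using eventually_ge_at_top[of k]
    proof eventually_elim
      case (elim j)
      then show ?case using HkVj[of k j] mleM[of j] V(1)[of j] by (simp add: H_def)
    qed
    then show ?thesis
      using Lim_in_closed_set[OF cl _ sequentially_bot v] by blast
  qed
  have "h k v + (norm (v - u))\<^sup>2 \<le> M" for k
    by (rule field_le_epsilon) (use vk[of _ k] in force)
  then show ?thesis
    using that[of v m M] vk[of 1] mM m_le by (simp add: H_def)
qed

section \<open>Composite minimization\<close>

text \<open>\<open>D\<close> stands for the effective domain of an extended-real-valued function and
  \<open>\<phi>\<close> for its finite values there; closed sublevel sets express lower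
  semicontinuity. \<open>xm\<close> is any minimizer, not necessarily the one of least norm.\<close>

locale composite_problem =
  fixes D :: "'a::{real_inner, complete_space} set" and \<phi> g :: "'a \<Rightarrow> real"
    and grad :: "'a \<Rightarrow> 'a" and L :: real and xm :: 'a
  assumes convex_phi: "convex_on D \<phi>"
    and closed_phi: "\<And>b. closed {v \<in> D. \<phi> v \<le> b}"
    and convex_g: "convex_on UNIV g"
    and gderiv_g: "\<And>z. GDERIV g z :> grad z"
    and L_pos: "0 < L"
    and lipschitz_grad: "L-lipschitz_on UNIV grad"
    and xm_D: "xm \<in> D"
    and xm_min: "\<And>z. z \<in> D \<Longrightarrow> \<phi> xm + g xm \<le> \<phi> z + g z"
begin

definition F :: "'a \<Rightarrow> real" where "F z = \<phi> z + g z"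

lemma convex_F: "convex_on D F"
  unfolding F_def
  using convex_phi convex_on_subset[OF convex_g subset_UNIV convex_on_imp_convex[OF convex_phi]]
  by (rule convex_on_add)

lemma closed_F: "closed {v \<in> D. F v \<le> b}"
  unfolding closed_sequential_limits
proof (intro allI impI, elim conjE)
  fix V v assume V: "\<forall>n. V n \<in> {v \<in> D. F v \<le> b}" and lim: "V \<longlonglongrightarrow> v"
  have "isCont g v"
    using gderiv_g has_derivative_continuous unfolding gderiv_def by blast
  then have glim: "(\<lambda>n. g (V n)) \<longlonglongrightarrow> g v"
    using lim by (rule isCont_tendsto_compose)
  \<comment> \<open>Continuity of \<open>g\<close> trades \<open>F (V n) \<le> b\<close> for a bound
    on \<open>\<phi> (V n)\<close> by a fixed level, eventually and up to \<open>d\<close>.\<close>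
  have vd: "v \<in> D \<and> \<phi> v \<le> b - g v + d" if d: "d > 0" for d
  proof -
    have "\<forall>\<^sub>F n in sequentially. g v - d < g (V n)"
      using glim d by (intro order_tendstoD(1)) auto
    then have "\<forall>\<^sub>F n in sequentially. V n \<in> {z \<in> D. \<phi> z \<le> b - g v + d}"
    proof eventually_elim
      case (elim n)
      then show ?case using V[rule_format, of n] by (simp add: F_def)
    qed
    then show ?thesis
      using Lim_in_closed_set[OF closed_phi _ sequentially_bot lim] by blast
  qed
  have "F v \<le> b"
    by (rule field_le_epsilon) (use vd in \<open>force simp: F_def\<close>)
  then show "v \<in> {v \<in> D. F v \<le> b}" using vd[of 1] by simp
qed

text \<open>At the minimizer \<open>xm\<close> the vector \<open>- grad xm\<close> is a subgradient
  of \<open>\<phi>\<close>; the resulting affine minorant bounds the proximal objective from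
  below.\<close>

lemma phi_affine_minorant:
  assumes "z \<in> D"
  shows "\<phi> xm - inner (grad xm) (z - xm) \<le> \<phi> z"
  using convex_phi xm_D xm_min descent_lemma[OF gderiv_g lipschitz_grad] assms
  by (rule minimizer_subgradient)

lemma prox_exists:
  assumes s: "0 < s"
  obtains p where "p \<in> D"
    and "\<And>z. z \<in> D \<Longrightarrow> \<phi> p + 1 / (2 * s) * (norm (p - u))\<^sup>2 \<le> \<phi> z + 1 / (2 * s) * (norm (z - u))\<^sup>2"
proof -
  \<comment> \<open>A constant sequence, scaled by \<open>2 * s\<close> so that the proximal
    objective becomes \<open>h\<close> plus a plain squared norm. \<open>B\<close> comes from the
    affine minorant by completing the square with
    \<open>(v - u) - s *\<^sub>R grad xm\<close>.\<close>
  define h where "h k v = 2 * s * \<phi> v" for k :: nat and v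
  define B where "B = 2 * s * \<phi> xm - 2 * s * inner (grad xm) (u - xm) - s\<^sup>2 * (norm (grad xm))\<^sup>2"
  have cl: "closed {v \<in> D. h k v \<le> b}" for k b
  proof -
    have "{v \<in> D. h k v \<le> b} = {v \<in> D. \<phi> v \<le> b / (2 * s)}"
      using s by (auto simp: h_def field_simps)
    then show ?thesis using closed_phi by simp
  qed
  have lower: "B \<le> h 0 v + (norm (v - u))\<^sup>2" if v: "v \<in> D" for v
  proof -
    have "2 * s * (\<phi> xm - inner (grad xm) (v - xm)) \<le> h 0 v"
      unfolding h_def using phi_affine_minorant[OF v] s by simp
    moreover have "v - xm = (v - u) + (u - xm)" by simp
    moreover have "0 \<le> (norm ((v - u) - s *\<^sub>R grad xm))\<^sup>2" by simp
    moreover have "(norm ((v - u) - s *\<^sub>R grad xm))\<^sup>2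
        = (norm (v - u))\<^sup>2 - 2 * s * inner (grad xm) (v - u) + s\<^sup>2 * (norm (grad xm))\<^sup>2"
      unfolding power2_norm_eq_inner inner_diff_left[of "v - u" "s *\<^sub>R grad xm"]
        inner_diff_right[of _ "v - u" "s *\<^sub>R grad xm"]
      by (simp add: inner_commute power2_eq_square)
    ultimately show ?thesis
      by (simp only: B_def inner_add_right) (simp add: algebra_simps)
  qed
  have conv: "convex_on D (h k)" for k
    unfolding h_def using s convex_phi by (intro convex_on_cmul) simp_all
  have ne: "D \<noteq> {}" using xm_D by blast
  have mono: "h j v \<le> h k v" if "v \<in> D" "j \<le> k" for j k v by (simp add: h_def)
  have "h k xm \<le> h 0 xm" for k by (simp add: h_def)
  then obtain p m M where p: "p \<in> D" and mM: "m \<longlonglongrightarrow> M"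
    and m: "\<And>k z. z \<in> D \<Longrightarrow> m k \<le> h k z + (norm (z - u))\<^sup>2"
    and M: "\<And>k. h k p + (norm (p - u))\<^sup>2 \<le> M"
    using strongly_convex_incseq_min[where h = h and D = D and u = u and B = B, OF conv ne cl mono lower xm_D]
    by metis
  show ?thesis
  proof (rule that[OF p])
    fix z assume z: "z \<in> D"
    have "M \<le> h 0 z + (norm (z - u))\<^sup>2"
      by (rule LIMSEQ_le_const2[OF mM]) (use m[OF z] in \<open>auto simp: h_def\<close>)
    with M[of 0] have "2 * s * \<phi> p + (norm (p - u))\<^sup>2 \<le> 2 * s * \<phi> z + (norm (z - u))\<^sup>2"
      by (simp add: h_def)
    then have "(2 * s * \<phi> p + (norm (p - u))\<^sup>2) / (2 * s) \<le> (2 * s * \<phi> z + (norm (z - u))\<^sup>2) / (2 * s)"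
      using s by (intro divide_right_mono) auto
    then show "\<phi> p + 1 / (2 * s) * (norm (p - u))\<^sup>2 \<le> \<phi> z + 1 / (2 * s) * (norm (z - u))\<^sup>2"
      using s by (simp add: add_divide_distrib)
  qed
qed

text \<open>The optimality condition of the proximal problem: the quadratic is expanded exactly
  around \<open>p\<close>, where its gradient is \<open>(1 / s) *\<^sub>R (p - u)\<close>, and
  \<open>minimizer_subgradient\<close> applies.\<close>

lemma prox_subgradient:
  assumes s: "0 < s" and p: "p \<in> D"
    and min: "\<And>z. z \<in> D \<Longrightarrow> \<phi> p + 1 / (2 * s) * (norm (p - u))\<^sup>2 \<le> \<phi> z + 1 / (2 * s) * (norm (z - u))\<^sup>2"
    and z: "z \<in> D"
  shows "\<phi> p + inner ((1 / s) *\<^sub>R (u - p)) (z - p) \<le> \<phi> z"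
proof -
  have expand: "1 / (2 * s) * (norm (z - u))\<^sup>2
      = 1 / (2 * s) * (norm (p - u))\<^sup>2 + 1 / s * inner (p - u) (z - p) + 1 / (2 * s) * (norm (z - p))\<^sup>2"
    for z
  proof -
    have "z - u = (z - p) + (p - u)" by simp
    then have "(norm (z - u))\<^sup>2 = (norm (z - p))\<^sup>2 + 2 * inner (p - u) (z - p) + (norm (p - u))\<^sup>2"
      unfolding power2_norm_eq_inner
      by (simp only: inner_add_left inner_add_right) (simp add: inner_commute)
    then show ?thesis using s by (simp add: field_simps)
  qed
  have "1 / (2 * s) * (norm (z - u))\<^sup>2
      \<le> 1 / (2 * s) * (norm (p - u))\<^sup>2 + inner ((1 / s) *\<^sub>R (p - u)) (z - p) + 1 / (2 * s) * (norm (z - p))\<^sup>2"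
    for z
    unfolding expand[of z] by simp
  then have "\<phi> p - inner ((1 / s) *\<^sub>R (p - u)) (z - p) \<le> \<phi> z"
    using minimizer_subgradient[where \<psi> = "\<lambda>z. 1 / (2 * s) * (norm (z - u))\<^sup>2",
        OF convex_phi p min _ z] by blast
  moreover have "(1 / s) *\<^sub>R (u - p) = - ((1 / s) *\<^sub>R (p - u))"
    by (simp flip: scaleR_minus_right)
  ultimately show ?thesis by (simp only: inner_minus_left)
qed

lemma F_ge_min: "z \<in> D \<Longrightarrow> F xm \<le> F z"
  using xm_min by (simp add: F_def)

text \<open>The functions \<open>2 / e k * (F z - F xm)\<close> increase with \<open>k\<close> and
  vanish at the minimizers, so \<open>strongly_convex_incseq_min\<close> applies with
  \<open>u = 0\<close>. The numbers \<open>m k\<close> bound the rescaled Tikhonov objective from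
  below, and the last conclusion measures the distance to \<open>v\<close> by the excess over these
  bounds.\<close>

lemma tikhonov_limit:
  assumes e: "\<And>k. 0 < e k" "decseq e" "e \<longlonglongrightarrow> 0"
  obtains v m where "v \<in> D" and "F v = F xm"
    and "\<And>z. z \<in> D \<Longrightarrow> F z = F xm \<Longrightarrow> norm v \<le> norm z"
    and "m \<longlonglongrightarrow> (norm v)\<^sup>2"
    and "\<And>k z. z \<in> D \<Longrightarrow> m k \<le> 2 / e k * (F z - F xm) + (norm z)\<^sup>2"
    and "\<And>k z. z \<in> D \<Longrightarrow>
      (norm (z - v))\<^sup>2 \<le> 2 * (2 / e k * (F z - F xm) + (norm z)\<^sup>2) + 2 * (norm v)\<^sup>2 - 4 * m k"
proof -
  define h where "h k v = 2 / e k * (F v + - F xm)" for k v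
  have h_nonneg: "0 \<le> h k z" if "z \<in> D" for k z
    using F_ge_min[OF that] e(1)[of k] by (simp add: h_def)
  have cl: "closed {v \<in> D. h k v \<le> b}" for k b
  proof -
    have "{v \<in> D. h k v \<le> b} = {v \<in> D. F v \<le> F xm + b * e k / 2}"
      using e(1)[of k] by (auto simp: h_def field_simps)
    then show ?thesis using closed_F by simp
  qed
  have conv: "convex_on D (h k)" for k
    unfolding h_def
    by (intro convex_on_cmul convex_on_add convex_F convex_on_const[THEN iffD2] convex_on_imp_convex[OF convex_F])
      (use e(1)[of k] in simp)
  have ne: "D \<noteq> {}" using xm_D by blast
  have mono: "h j v \<le> h k v" if "v \<in> D" "j \<le> k" for j k v
    unfolding h_def using F_ge_min[OF that(1)] e(1)[of k] decseqD[OF e(2) that(2)]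
    by (intro mult_right_mono divide_left_mono) (auto simp: e(1))
  have lower: "0 \<le> h 0 v + (norm (v - 0))\<^sup>2" if "v \<in> D" for v
    using h_nonneg[OF that] by simp
  have "h k xm \<le> 0" for k by (simp add: h_def)
  then obtain v m M where v: "v \<in> D" and mM: "m \<longlonglongrightarrow> M"
    and m: "\<And>k z. z \<in> D \<Longrightarrow> m k \<le> h k z + (norm (z - 0))\<^sup>2"
    and M: "\<And>k. h k v + (norm (v - 0))\<^sup>2 \<le> M"
    using strongly_convex_incseq_min[where h = h and D = D and u = 0 and B = 0, OF conv ne cl mono lower xm_D]
    by metis
  \<comment> \<open>The bound \<open>h k v \<le> M\<close>, uniform in \<open>k\<close>, means
    \<open>F v - F xm \<le> e k * M / 2\<close>, and \<open>e\<close> tends to 0.\<close>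
  have "F v - F xm \<le> 0"
  proof (rule LIMSEQ_le_const)
    show "(\<lambda>k. e k * M / 2) \<longlonglongrightarrow> 0"
      using tendsto_mult_left[OF e(3), of "M / 2"] by (simp add: mult.commute)
    have "F v - F xm \<le> e k * M / 2" for k
    proof -
      have "h k v \<le> M" using order_trans[OF _ M[of k]] by simp
      then show ?thesis using e(1)[of k] by (simp add: h_def field_simps)
    qed
    then show "\<exists>N. \<forall>n\<ge>N. F v - F xm \<le> e n * M / 2" by blast
  qed
  then have Fv: "F v = F xm" using F_ge_min[OF v] by simp
  have M_le: "M \<le> (norm z)\<^sup>2" if "z \<in> D" "F z = F xm" for z
    by (rule LIMSEQ_le_const2[OF mM]) (use m[OF that(1)] that(2) in \<open>auto simp: h_def\<close>)
  have le_M: "(norm v)\<^sup>2 \<le> M"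
    using M[of 0] h_nonneg[OF v, of 0] by simp
  have M_eq: "M = (norm v)\<^sup>2" using M_le[OF v Fv] le_M by simp
  have norm_le: "norm v \<le> norm z" if "z \<in> D" "F z = F xm" for z
    by (rule power2_le_imp_le) (use order_trans[OF le_M M_le[OF that]] in auto)
  have mid: "(norm (z - v))\<^sup>2 \<le> 2 * (h k z + (norm z)\<^sup>2) + 2 * (norm v)\<^sup>2 - 4 * m k" if "z \<in> D" for k z
    using convex_plus_norm_midpoint[OF conv that v, of "m k" k 0] m[of _ k] Fv by (simp add: h_def)
  have m': "m k \<le> 2 / e k * (F z - F xm) + (norm z)\<^sup>2" if "z \<in> D" for k z
    using m[OF that, of k] by (simp add: h_def)
  have mid': "(norm (z - v))\<^sup>2 \<le> 2 * (2 / e k * (F z - F xm) + (norm z)\<^sup>2) + 2 * (norm v)\<^sup>2 - 4 * m k"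
    if "z \<in> D" for k z
    using mid[OF that, of k] by (simp add: h_def)
  show ?thesis
    by (rule that[OF v Fv norm_le mM[unfolded M_eq] m' mid'])
qed

text \<open>The descent lemma bounds \<open>g p\<close> from above, the tangent at \<open>y\<close>
  bounds \<open>g z\<close> from below, and the proximal subgradient handles \<open>\<phi>\<close>.
  The Tikhonov term belongs to the smooth part, whose gradient is then
  \<open>(L + ep)\<close>-Lipschitz; hence the form of the step condition.\<close>

lemma prox_grad_inequality:
  assumes s: "0 < s" and ep: "0 \<le> ep" and step: "s * (L + ep) \<le> 1"
    and p: "p \<in> D" and z: "z \<in> D"
    and sub: "\<phi> p + inner ((1 / s) *\<^sub>R ((y - s *\<^sub>R grad y - (s * ep) *\<^sub>R y) - p)) (z - p) \<le> \<phi> z"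
  shows "F p + ep / 2 * (norm p)\<^sup>2 + 1 / (2 * s) * (norm (p - z))\<^sup>2
      \<le> F z + ep / 2 * (norm z)\<^sup>2 + 1 / (2 * s) * (norm (y - z))\<^sup>2"
proof -
  have g1: "g y + inner (grad y) (z - y) \<le> g z"
    by (rule convex_ge_tangent[OF convex_g gderiv_g])
  have g2: "g p \<le> g y + inner (grad y) (p - y) + L / 2 * (norm (p - y))\<^sup>2"
    by (rule descent_lemma[OF gderiv_g lipschitz_grad])
  have split: "inner (grad y) (p - y) = inner (grad y) (z - y) - inner (grad y) (z - p)"
    by (simp add: inner_diff_right)
  have eq: "(1 / s) *\<^sub>R ((y - s *\<^sub>R grad y - (s * ep) *\<^sub>R y) - p)
      = (1 / s) *\<^sub>R (y - p) - grad y - ep *\<^sub>R y"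
    using s by (simp add: scaleR_diff_right)
  have sub': "\<phi> p + 1 / s * inner (y - p) (z - p) - inner (grad y) (z - p) - ep * inner y (z - p) \<le> \<phi> z"
    using sub unfolding eq by (simp add: inner_diff_left)
  have inner_eq_norms: "inner (y - p) (z - p) = ((norm (p - y))\<^sup>2 + (norm (p - z))\<^sup>2 - (norm (y - z))\<^sup>2) / 2"
    unfolding power2_norm_eq_inner by (simp add: inner_diff_left inner_diff_right inner_commute)
  have three: "1 / s * inner (y - p) (z - p)
      = 1 / (2 * s) * (norm (p - y))\<^sup>2 + 1 / (2 * s) * (norm (p - z))\<^sup>2 - 1 / (2 * s) * (norm (y - z))\<^sup>2"
    unfolding inner_eq_norms using s by (simp add: add_divide_distrib diff_divide_distrib)
  have quad: "ep * inner y (z - p) = ep / 2 * (norm z)\<^sup>2 - ep / 2 * (norm p)\<^sup>2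
      + ep / 2 * (norm (p - y))\<^sup>2 - ep / 2 * (norm (y - z))\<^sup>2"
  proof -
    have "inner y (z - p) = ((norm z)\<^sup>2 - (norm p)\<^sup>2 + (norm (p - y))\<^sup>2 - (norm (y - z))\<^sup>2) / 2"
      unfolding power2_norm_eq_inner by (simp add: inner_diff_left inner_diff_right inner_commute)
    then show ?thesis by (simp only:) (simp add: algebra_simps add_divide_distrib diff_divide_distrib)
  qed
  \<comment> \<open>The multiple \<open>1 / (2 * s)\<close> of \<open>(norm (p - y))\<^sup>2\<close>
    supplied by the subgradient inequality absorbs the curvature terms of \<open>g\<close> and of
    the regularization.\<close>
  have "L / 2 + ep / 2 \<le> 1 / (2 * s)"
    using step s by (simp add: field_simps)
  then have "(L / 2 + ep / 2) * (norm (p - y))\<^sup>2 \<le> 1 / (2 * s) * (norm (p - y))\<^sup>2"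
    by (intro mult_right_mono) auto
  moreover have "0 \<le> ep / 2 * (norm (y - z))\<^sup>2" using ep by simp
  ultimately show ?thesis
    using g1 g2 sub' unfolding F_def split three quad by (simp add: distrib_right)
qed

end

section \<open>Energy estimates for the inertial iteration\<close>

lemma norm_convex_combination_le:
  fixes u v :: "'a::real_inner"
  assumes r: "0 \<le> r" "r \<le> 1"
  shows "(norm ((1 - r) *\<^sub>R u + r *\<^sub>R v))\<^sup>2 \<le> (1 - r) * (norm u)\<^sup>2 + r * (norm v)\<^sup>2"
proof -
  have "(1 - r) * (norm u)\<^sup>2 + r * (norm v)\<^sup>2 - (norm ((1 - r) *\<^sub>R u + r *\<^sub>R v))\<^sup>2
      = r * (1 - r) * (norm (u - v))\<^sup>2"
    unfolding power2_norm_eq_inner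
    by (simp add: inner_add_left inner_add_right inner_diff_left inner_diff_right inner_commute
        algebra_simps)
  also have "\<dots> \<ge> 0" using r by simp
  finally show ?thesis by simp
qed

text \<open>From some \<open>N\<close> on, each new value is at most a convex combination of the old
  one and \<open>M\<close>, so \<open>max (e N) M\<close> is never exceeded.\<close>

lemma contraction_bounded:
  fixes e \<theta> :: "nat \<Rightarrow> real"
  assumes "\<forall>\<^sub>F k in sequentially. 0 \<le> \<theta> k \<and> \<theta> k \<le> 1 \<and> e (Suc k) \<le> \<theta> k * e k + (1 - \<theta> k) * M"
  shows "\<exists>C. \<forall>\<^sub>F k in sequentially. e k \<le> C"
proof -
  from assms obtain N where
    N: "\<And>k. k \<ge> N \<Longrightarrow> 0 \<le> \<theta> k \<and> \<theta> k \<le> 1 \<and> e (Suc k) \<le> \<theta> k * e k + (1 - \<theta> k) * M"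
    by (auto simp: eventually_sequentially)
  have "e k \<le> max (e N) M" if "N \<le> k" for k
    using that
  proof (induction rule: dec_induct)
    case (step k)
    have "\<theta> k * e k + (1 - \<theta> k) * M \<le> \<theta> k * max (e N) M + (1 - \<theta> k) * max (e N) M"
      using N[of k] step by (intro add_mono mult_left_mono) auto
    also have "\<dots> = max (e N) M" by (simp add: algebra_simps)
    finally show ?case using N[of k] step by linarith
  qed simp
  then show ?thesis by (auto simp: eventually_sequentially)
qed

lemma summable_perturbation_bounded:
  fixes e d \<theta> :: "nat \<Rightarrow> real"
  assumes ev: "\<forall>\<^sub>F k in sequentially. 0 \<le> \<theta> k \<and> \<theta> k \<le> 1 \<and> 0 \<le> d k \<and> e (Suc k) \<le> \<theta> k * e k + d k"
    and d: "summable d"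
  shows "\<exists>C. \<forall>\<^sub>F k in sequentially. e k \<le> C"
proof -
  from ev obtain N where
    N: "\<And>k. k \<ge> N \<Longrightarrow> 0 \<le> \<theta> k \<and> \<theta> k \<le> 1 \<and> 0 \<le> d k \<and> e (Suc k) \<le> \<theta> k * e k + d k"
    by (auto simp: eventually_sequentially)
  have d': "summable (\<lambda>n. d (n + N))" using d by simp
  \<comment> \<open>The maximum with 0 keeps the accumulated bound nonnegative, so that multiplying
    it by \<open>\<theta> (n + N) \<le> 1\<close> does not increase it.\<close>
  have le: "e (n + N) \<le> max (e N) 0 + (\<Sum>i<n. d (i + N))" for n
  proof (induction n)
    case (Suc n)
    have S: "0 \<le> max (e N) 0 + (\<Sum>i<n. d (i + N))"
      using N by (intro add_nonneg_nonneg sum_nonneg) auto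
    have "\<theta> (n + N) * e (n + N) \<le> \<theta> (n + N) * (max (e N) 0 + (\<Sum>i<n. d (i + N)))"
      using N[of "n + N"] Suc by (intro mult_left_mono) auto
    also have "\<dots> \<le> max (e N) 0 + (\<Sum>i<n. d (i + N))"
      using N[of "n + N"] S mult_right_mono[of "\<theta> (n + N)" 1] by auto
    finally show ?case using N[of "n + N"] by simp
  qed simp
  have "e k \<le> max (e N) 0 + (\<Sum>i. d (i + N))" if "k \<ge> N" for k
    using le[of "k - N"] sum_le_suminf[OF d', of "{..<k - N}"] N that by auto
  then show ?thesis by (auto simp: eventually_sequentially)
qed

text \<open>The proximal step is recorded through the subgradient inequality it satisfies, and
  \<open>t_growth\<close> says that \<open>\<theta> k \<le> 1\<close> for \<open>\<theta>\<close>
  below. The points \<open>x 0\<close> and \<open>x 1\<close> are arbitrary, so membership in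
  \<open>D\<close> starts at index 2.\<close>

locale inertial_tikhonov = composite_problem +
  fixes s :: real and eps t :: "nat \<Rightarrow> real" and x y :: "nat \<Rightarrow> 'a"
  assumes s_pos: "0 < s" and s_L: "s * L < 1"
    and eps_pos: "\<And>k. 1 \<le> k \<Longrightarrow> 0 < eps k"
    and eps_dec: "\<And>k. 1 \<le> k \<Longrightarrow> eps (Suc k) \<le> eps k"
    and eps_lim: "eps \<longlonglongrightarrow> 0"
    and t_ge: "\<And>k. 1 \<le> k \<Longrightarrow> 1 \<le> t k"
    and t_mono: "\<And>k. 1 \<le> k \<Longrightarrow> t k \<le> t (Suc k)"
    and t_growth: "\<And>k. 1 \<le> k \<Longrightarrow> (t (Suc k))\<^sup>2 - t (Suc k) \<le> (t k)\<^sup>2"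
    and y_eq: "\<And>k. 1 \<le> k \<Longrightarrow> y k = (1 - 1 / t (Suc k)) *\<^sub>R x k
        + ((t (Suc k) - 1) / (t k)\<^sup>2) *\<^sub>R (x (k - 1) + t k *\<^sub>R (x k - x (k - 1)))"
    and x_D: "\<And>k. 1 \<le> k \<Longrightarrow> x (Suc k) \<in> D"
    and x_prox: "\<And>k w. 1 \<le> k \<Longrightarrow> w \<in> D \<Longrightarrow>
        \<phi> (x (Suc k)) + inner ((1 / s) *\<^sub>R ((y k - s *\<^sub>R grad (y k) - (s * eps k) *\<^sub>R y k) - x (Suc k)))
          (w - x (Suc k)) \<le> \<phi> w"
begin

definition z :: "nat \<Rightarrow> 'a" where "z k = x (k - 1) + t k *\<^sub>R (x k - x (k - 1))"

definition \<theta> :: "nat \<Rightarrow> real" where "\<theta> k = ((t (Suc k))\<^sup>2 - t (Suc k)) / (t k)\<^sup>2"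

text \<open>For \<open>k \<ge> 2\<close> the point \<open>x k\<close> results from a step with
  regularization weight \<open>eps (k - 1)\<close>, which is therefore the weight paired with
  it.\<close>

definition E :: "'a \<Rightarrow> nat \<Rightarrow> real" where
  "E w k = (t k)\<^sup>2 * (F (x k) - F w + eps (k - 1) / 2 * ((norm (x k))\<^sup>2 - (norm w)\<^sup>2))
     + 1 / (2 * s) * (norm (z k - w))\<^sup>2"

lemma x_in_D: "2 \<le> k \<Longrightarrow> x k \<in> D"
  using x_D[of "k - 1"] by (cases k) auto

lemma theta_bounds: "1 \<le> k \<Longrightarrow> 0 \<le> \<theta> k \<and> \<theta> k \<le> 1"
  using t_ge[of k] t_ge[of "Suc k"] t_growth[of k] mult_right_mono[of 1 "t (Suc k)" "t (Suc k)"]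
  unfolding \<theta>_def by (auto simp: power2_eq_square intro!: divide_nonneg_nonneg)

text \<open>The proximal gradient inequality is applied at \<open>pt\<close> and multiplied by
  \<open>T\<^sup>2\<close>. The perturbation has two sources: the change of weight between
  \<open>eps (k - 1)\<close> and \<open>eps k\<close>, and the shrinking of the momentum point by
  \<open>\<theta> k\<close>.\<close>

lemma energy_step:
  assumes k: "2 \<le> k" and small: "s * (L + eps k) \<le> 1" and w: "w \<in> D"
  shows "E w (Suc k) \<le> \<theta> k * E w k
    + (norm w)\<^sup>2 * ((t (Suc k))\<^sup>2 * (eps (k - 1) - eps k) / 2 + (1 - \<theta> k) / (2 * s))"
proof -
  define T where "T = t (Suc k)"
  define c where "c = 1 / (2 * s)"
  define G where "G v = F v - F w + eps k / 2 * ((norm v)\<^sup>2 - (norm w)\<^sup>2)" for v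
  have T1: "1 \<le> T" using t_ge[of "Suc k"] k by (simp add: T_def)
  have tk: "1 \<le> t k" using t_ge[of k] k by simp
  have c: "0 \<le> c" using s_pos by (simp add: c_def)
  define pt where "pt = (1 - 1 / T) *\<^sub>R x k + (1 / T) *\<^sub>R w"
  have xk: "x k \<in> D" by (rule x_in_D[OF k])
  have r: "0 \<le> 1 / T" "1 / T \<le> 1" using T1 by auto
  have pt: "pt \<in> D"
    using convexD_alt[OF convex_on_imp_convex[OF convex_F] xk w r] by (simp add: pt_def)
  \<comment> \<open>Scaled by \<open>T\<close>, both differences with \<open>pt\<close> become
    differences with \<open>w\<close>: of \<open>z (Suc k)\<close> for the new point, of
    \<open>\<theta> k *\<^sub>R z k\<close> for \<open>y k\<close>.\<close>
  have zt: "x (Suc k) - pt = (1 / T) *\<^sub>R (z (Suc k) - w)"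
    using T1 by (simp add: pt_def z_def T_def algebra_simps)
  have "(T - 1) / (t k)\<^sup>2 = \<theta> k / T"
    using T1 tk by (simp add: \<theta>_def T_def[symmetric] field_simps power2_eq_square)
  then have yt: "y k - pt = (1 / T) *\<^sub>R (\<theta> k *\<^sub>R z k - w)"
    using y_eq[of k] k by (simp add: pt_def z_def[of k] T_def[symmetric] scaleR_diff_right)
  have e0: "0 \<le> eps k" using eps_pos[of k] k by simp
  have "F (x (Suc k)) + eps k / 2 * (norm (x (Suc k)))\<^sup>2 + c * (norm (x (Suc k) - pt))\<^sup>2
      \<le> F pt + eps k / 2 * (norm pt)\<^sup>2 + c * (norm (y k - pt))\<^sup>2"
    unfolding c_def using k
    by (intro prox_grad_inequality[OF s_pos e0 small x_D pt x_prox[OF _ pt]]) auto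
  then have "G (x (Suc k)) + c * (norm (x (Suc k) - pt))\<^sup>2 \<le> G pt + c * (norm (y k - pt))\<^sup>2"
    by (simp add: G_def algebra_simps)
  moreover have "G pt \<le> (1 - 1 / T) * G (x k)"
  proof -
    have "F pt \<le> (1 - 1 / T) * F (x k) + 1 / T * F w"
      unfolding pt_def using convex_onD[OF convex_F r xk w] by simp
    moreover have "eps k / 2 * (norm pt)\<^sup>2 \<le> eps k / 2 * ((1 - 1 / T) * (norm (x k))\<^sup>2 + 1 / T * (norm w)\<^sup>2)"
      unfolding pt_def using e0 norm_convex_combination_le[OF r] by (intro mult_left_mono) auto
    ultimately show ?thesis by (simp add: G_def algebra_simps diff_divide_distrib)
  qed
  ultimately have "G (x (Suc k)) + c * (norm (x (Suc k) - pt))\<^sup>2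
      \<le> (1 - 1 / T) * G (x k) + c * (norm (y k - pt))\<^sup>2" by linarith
  then have "T\<^sup>2 * (G (x (Suc k)) + c * (norm (x (Suc k) - pt))\<^sup>2)
      \<le> T\<^sup>2 * ((1 - 1 / T) * G (x k) + c * (norm (y k - pt))\<^sup>2)"
    by (intro mult_left_mono) auto
  then have "T\<^sup>2 * G (x (Suc k)) + c * (T\<^sup>2 * (norm (x (Suc k) - pt))\<^sup>2)
      \<le> T\<^sup>2 * (1 - 1 / T) * G (x k) + c * (T\<^sup>2 * (norm (y k - pt))\<^sup>2)"
    by (simp add: algebra_simps)
  moreover have "T\<^sup>2 * (norm (x (Suc k) - pt))\<^sup>2 = (norm (z (Suc k) - w))\<^sup>2"
    unfolding zt using T1 by (simp add: power_divide)
  moreover have "T\<^sup>2 * (norm (y k - pt))\<^sup>2 = (norm (\<theta> k *\<^sub>R z k - w))\<^sup>2"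
    unfolding yt using T1 by (simp add: power_divide)
  moreover have "T\<^sup>2 * (1 - 1 / T) = \<theta> k * (t k)\<^sup>2"
    using T1 tk by (simp add: \<theta>_def T_def[symmetric] field_simps power2_eq_square)
  ultimately have main: "T\<^sup>2 * G (x (Suc k)) + c * (norm (z (Suc k) - w))\<^sup>2
      \<le> \<theta> k * (t k)\<^sup>2 * G (x k) + c * (norm (\<theta> k *\<^sub>R z k - w))\<^sup>2"
    by (simp only:)
  have \<theta>: "0 \<le> \<theta> k" "\<theta> k \<le> 1" using theta_bounds[of k] k by auto
  \<comment> \<open>Shrinking towards 0 gives a convex combination of \<open>z k - w\<close> and
    \<open>- w\<close>; convexity of the squared norm yields the factor \<open>\<theta> k\<close>
    and the remainder \<open>(1 - \<theta> k) * (norm w)\<^sup>2\<close>.\<close>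
  have "\<theta> k *\<^sub>R z k - w = (1 - (1 - \<theta> k)) *\<^sub>R (z k - w) + (1 - \<theta> k) *\<^sub>R (- w)"
    by (simp add: algebra_simps)
  then have "(norm (\<theta> k *\<^sub>R z k - w))\<^sup>2 \<le> \<theta> k * (norm (z k - w))\<^sup>2 + (1 - \<theta> k) * (norm w)\<^sup>2"
    using norm_convex_combination_le[of "1 - \<theta> k" "z k - w" "- w"] \<theta> by simp
  then have shrink: "c * (norm (\<theta> k *\<^sub>R z k - w))\<^sup>2
      \<le> c * (\<theta> k * (norm (z k - w))\<^sup>2 + (1 - \<theta> k) * (norm w)\<^sup>2)"
    using c by (rule mult_left_mono)
  \<comment> \<open>Half the drop of the regularization weight. Replacing \<open>eps k\<close> by
    \<open>eps (k - 1)\<close> in \<open>G\<close> leaves \<open>d * (norm w)\<^sup>2\<close>, while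
    the term with \<open>norm (x k)\<close> has the favourable sign.\<close>
  define d where "d = (eps (k - 1) - eps k) / 2"
  have d: "0 \<le> d" using eps_dec[of "k - 1"] k by (simp add: d_def)
  define G' where "G' = F (x k) - F w + eps (k - 1) / 2 * ((norm (x k))\<^sup>2 - (norm w)\<^sup>2)"
  have "G (x k) = G' + d * (norm w)\<^sup>2 - d * (norm (x k))\<^sup>2"
    by (simp add: G_def G'_def d_def field_simps)
  also have "\<dots> \<le> G' + d * (norm w)\<^sup>2" using d by simp
  finally have "\<theta> k * (t k)\<^sup>2 * G (x k) \<le> \<theta> k * (t k)\<^sup>2 * (G' + d * (norm w)\<^sup>2)"
    using \<theta> by (intro mult_left_mono) auto
  moreover have "\<theta> k * (t k)\<^sup>2 * (d * (norm w)\<^sup>2) \<le> T\<^sup>2 * (d * (norm w)\<^sup>2)"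
  proof (rule mult_right_mono)
    show "\<theta> k * (t k)\<^sup>2 \<le> T\<^sup>2" using tk T1 by (simp add: \<theta>_def T_def)
  qed (use d in simp)
  ultimately have "\<theta> k * (t k)\<^sup>2 * G (x k) \<le> \<theta> k * ((t k)\<^sup>2 * G') + T\<^sup>2 * (d * (norm w)\<^sup>2)"
    by (simp add: algebra_simps)
  with main shrink
  have "T\<^sup>2 * G (x (Suc k)) + c * (norm (z (Suc k) - w))\<^sup>2
      \<le> \<theta> k * ((t k)\<^sup>2 * G') + T\<^sup>2 * (d * (norm w)\<^sup>2)
        + c * (\<theta> k * (norm (z k - w))\<^sup>2 + (1 - \<theta> k) * (norm w)\<^sup>2)" by linarith
  moreover have "E w (Suc k) = T\<^sup>2 * G (x (Suc k)) + c * (norm (z (Suc k) - w))\<^sup>2"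
    by (simp add: E_def G_def T_def c_def)
  moreover have "E w k = (t k)\<^sup>2 * G' + c * (norm (z k - w))\<^sup>2"
    by (simp add: E_def G'_def c_def)
  moreover have "(norm w)\<^sup>2 * ((t (Suc k))\<^sup>2 * (eps (k - 1) - eps k) / 2 + (1 - \<theta> k) / (2 * s))
      = T\<^sup>2 * (d * (norm w)\<^sup>2) + c * ((1 - \<theta> k) * (norm w)\<^sup>2)"
    by (simp add: d_def c_def T_def algebra_simps diff_divide_distrib)
  ultimately show ?thesis by (simp add: algebra_simps)
qed

text \<open>The strict inequality \<open>s * L < 1\<close> leaves room for the vanishing
  \<open>eps k\<close>.\<close>

lemma eventually_small_step: "\<forall>\<^sub>F k in sequentially. s * (L + eps k) \<le> 1 \<and> 2 \<le> k"
proof -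
  have "(\<lambda>k. s * (L + eps k)) \<longlonglongrightarrow> s * (L + 0)" by (intro tendsto_intros eps_lim)
  then have "\<forall>\<^sub>F k in sequentially. s * (L + eps k) < 1"
    by (rule order_tendstoD) (use s_L in simp)
  then show ?thesis using eventually_ge_at_top[of 2] by eventually_elim simp
qed

lemma gap_le_energy:
  assumes "1 \<le> k"
  shows "F (x k) - F w \<le> E w k / (t k)\<^sup>2 + eps (k - 1) / 2 * ((norm w)\<^sup>2 - (norm (x k))\<^sup>2)"
proof -
  have "0 \<le> 1 / (2 * s) * (norm (z k - w))\<^sup>2" using s_pos by simp
  then have "(t k)\<^sup>2 * (F (x k) - F w + eps (k - 1) / 2 * ((norm (x k))\<^sup>2 - (norm w)\<^sup>2)) \<le> E w k"
    unfolding E_def by linarith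
  then have "F (x k) - F w + eps (k - 1) / 2 * ((norm (x k))\<^sup>2 - (norm w)\<^sup>2) \<le> E w k / (t k)\<^sup>2"
    using t_ge[OF assms] by (simp add: pos_le_divide_eq mult.commute)
  then show ?thesis by (simp add: algebra_simps)
qed

text \<open>Under \<open>B\<close> the whole perturbation is at most a constant multiple of
  \<open>1 - \<theta> k\<close>, so the recursion contracts towards a fixed level.\<close>

lemma energy_bounded_contraction:
  assumes w: "w \<in> D"
    and B: "\<forall>\<^sub>F k in sequentially. (t (Suc k))\<^sup>2 * (eps (k - 1) - eps k) \<le> B * (1 - \<theta> k)"
  shows "\<exists>C. \<forall>\<^sub>F k in sequentially. E w k \<le> C"
proof (rule contraction_bounded)
  show "\<forall>\<^sub>F k in sequentially. 0 \<le> \<theta> k \<and> \<theta> k \<le> 1 \<and>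
      E w (Suc k) \<le> \<theta> k * E w k + (1 - \<theta> k) * ((norm w)\<^sup>2 * (B / 2 + 1 / (2 * s)))"
    using B eventually_small_step
  proof eventually_elim
    case (elim k)
    have "(t (Suc k))\<^sup>2 * (eps (k - 1) - eps k) / 2 + (1 - \<theta> k) / (2 * s)
        \<le> (1 - \<theta> k) * (B / 2 + 1 / (2 * s))"
      using divide_right_mono[OF elim(1), of 2] by (simp add: algebra_simps)
    then have "(norm w)\<^sup>2 * ((t (Suc k))\<^sup>2 * (eps (k - 1) - eps k) / 2 + (1 - \<theta> k) / (2 * s))
        \<le> (norm w)\<^sup>2 * ((1 - \<theta> k) * (B / 2 + 1 / (2 * s)))"
      by (rule mult_left_mono) simp
    then show ?case using energy_step[of k w] theta_bounds[of k] elim w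
      by (simp add: mult.left_commute)
  qed
qed

text \<open>Serves the critical case \<open>a = 1 / 2\<close>, \<open>q = 1\<close>, where the
  factors \<open>\<theta> k\<close> have summable distance from 1.\<close>

lemma energy_bounded_summable:
  assumes w: "w \<in> D"
    and sum: "summable (\<lambda>k. (t (Suc k))\<^sup>2 * (eps (k - 1) - eps k))" "summable (\<lambda>k. 1 - \<theta> k)"
  shows "\<exists>C. \<forall>\<^sub>F k in sequentially. E w k \<le> C"
proof (rule summable_perturbation_bounded)
  show "\<forall>\<^sub>F k in sequentially. 0 \<le> \<theta> k \<and> \<theta> k \<le> 1 \<and>
      0 \<le> (norm w)\<^sup>2 * ((t (Suc k))\<^sup>2 * (eps (k - 1) - eps k) / 2 + (1 - \<theta> k) / (2 * s)) \<and>
      E w (Suc k) \<le> \<theta> k * E w k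
        + (norm w)\<^sup>2 * ((t (Suc k))\<^sup>2 * (eps (k - 1) - eps k) / 2 + (1 - \<theta> k) / (2 * s))"
    using eventually_small_step
  proof eventually_elim
    case (elim k)
    have "1 \<le> k - 1" using elim by linarith
    then have "eps k \<le> eps (k - 1)" using eps_dec[of "k - 1"] elim by simp
    then show ?case using energy_step[of k w] theta_bounds[of k] elim w s_pos
      by auto
  qed
  show "summable (\<lambda>k. (norm w)\<^sup>2 * ((t (Suc k))\<^sup>2 * (eps (k - 1) - eps k) / 2 + (1 - \<theta> k) / (2 * s)))"
    using sum by (intro summable_mult summable_add summable_divide)
qed

lemma gap_bigo_energy:
  assumes C: "\<forall>\<^sub>F k in sequentially. E w k \<le> C"
    and eps: "(\<lambda>k. eps (k - 1)) \<in> O(r)" and t: "(\<lambda>k. 1 / (t k)\<^sup>2) \<in> O(r)"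
    and w: "\<And>v. v \<in> D \<Longrightarrow> F w \<le> F v"
  shows "(\<lambda>k. F (x k) - F w) \<in> O(r)"
proof -
  have "\<forall>\<^sub>F k in sequentially. norm (F (x k) - F w)
      \<le> norm (C * (1 / (t k)\<^sup>2) + (norm w)\<^sup>2 / 2 * eps (k - 1))"
    using C eventually_ge_at_top[of 2]
  proof eventually_elim
    case (elim k)
    have "1 \<le> k - 1" using elim by linarith
    from eps_pos[OF this] have "0 \<le> eps (k - 1) / 2 * (norm (x k))\<^sup>2" by simp
    moreover have "E w k / (t k)\<^sup>2 \<le> C / (t k)\<^sup>2"
      using elim by (intro divide_right_mono) auto
    ultimately have "F (x k) - F w \<le> C / (t k)\<^sup>2 + (norm w)\<^sup>2 / 2 * eps (k - 1)"
      using gap_le_energy[of k w] elim by (simp add: algebra_simps)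
    then show ?case using w[OF x_in_D[OF elim(2)]] by simp
  qed
  then have "(\<lambda>k. F (x k) - F w) \<in> O(\<lambda>k. C * (1 / (t k)\<^sup>2) + (norm w)\<^sup>2 / 2 * eps (k - 1))"
    by (rule landau_o.big_mono)
  also have "(\<lambda>k. C * (1 / (t k)\<^sup>2) + (norm w)\<^sup>2 / 2 * eps (k - 1)) \<in> O(r)"
    by (intro sum_in_bigo cmult_in_bigo_iff[THEN iffD2] disjI2 eps t)
  finally show ?thesis .
qed

text \<open>Relative to \<open>P k = (t k)\<^sup>2 * eps (k - 1)\<close> the energy tends to 0. The
  quotient \<open>2 * E v k / P k\<close> is the excess of the rescaled Tikhonov objective at
  \<open>x k\<close> over \<open>(norm v)\<^sup>2\<close>, plus a nonnegative momentum term. The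
  bounds \<open>m\<close> keep the excess above a null sequence, so both parts vanish: the first
  gives convergence and the gap, the second the velocity.\<close>

lemma strong_convergence:
  assumes rate: "(\<lambda>k. t (Suc k) * (eps (k - 1) - eps k) / eps k) \<longlonglongrightarrow> 0"
    and large: "filterlim (\<lambda>k. (t k)\<^sup>2 * eps k) at_top sequentially"
  obtains v where "v \<in> D" and "F v = F xm"
    and "\<And>w. w \<in> D \<Longrightarrow> F w = F xm \<Longrightarrow> norm v \<le> norm w"
    and "\<And>w. w \<in> D \<Longrightarrow> F w = F xm \<Longrightarrow> norm w \<le> norm v \<Longrightarrow> w = v"
    and "x \<longlonglongrightarrow> v"
    and "(\<lambda>k. (norm (x k - x (k - 1)))\<^sup>2 / eps (k - 1)) \<longlonglongrightarrow> 0"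
    and "\<forall>\<^sub>F k in sequentially. F (x k) - F xm \<le> ((norm v)\<^sup>2 + 1) * eps (k - 1)"
proof -
  \<comment> \<open>Index shift: positivity and monotonicity of \<open>eps\<close> are given from
    index 1 on.\<close>
  define e where "e = (\<lambda>k. eps (Suc k))"
  have e: "\<And>k. 0 < e k" "decseq e" "e \<longlonglongrightarrow> 0"
    using eps_pos eps_dec LIMSEQ_Suc[OF eps_lim] by (auto simp: e_def decseq_Suc_iff)
  obtain v m where v: "v \<in> D" and Fv: "F v = F xm"
    and norm_min: "\<And>w. w \<in> D \<Longrightarrow> F w = F xm \<Longrightarrow> norm v \<le> norm w"
    and m_lim: "m \<longlonglongrightarrow> (norm v)\<^sup>2"
    and m_le: "\<And>k w. w \<in> D \<Longrightarrow> m k \<le> 2 / e k * (F w - F xm) + (norm w)\<^sup>2"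
    and mid: "\<And>k w. w \<in> D \<Longrightarrow>
      (norm (w - v))\<^sup>2 \<le> 2 * (2 / e k * (F w - F xm) + (norm w)\<^sup>2) + 2 * (norm v)\<^sup>2 - 4 * m k"
    using tikhonov_limit[OF e] by blast
  have unique: "w = v" if w: "w \<in> D" "F w = F xm" "norm w \<le> norm v" for w
  proof -
    have "norm w = norm v" using norm_min[OF w(1,2)] w(3) by simp
    then have "\<exists>N. \<forall>k\<ge>N. (norm (w - v))\<^sup>2 \<le> 4 * (norm v)\<^sup>2 - 4 * m k"
      using mid[OF w(1)] w(2) by simp
    moreover have "(\<lambda>k. 4 * (norm v)\<^sup>2 - 4 * m k) \<longlonglongrightarrow> 4 * (norm v)\<^sup>2 - 4 * (norm v)\<^sup>2"
      by (intro tendsto_intros m_lim)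
    ultimately have "(norm (w - v))\<^sup>2 \<le> 0" using LIMSEQ_le_const by fastforce
    then show ?thesis by simp
  qed

  \<comment> \<open>Smallness of the energy relative to \<open>P\<close>\<close>
  define P where "P k = (t k)\<^sup>2 * eps (k - 1)" for k
  have P_pos: "0 < P k" if "2 \<le> k" for k
  proof -
    have "1 \<le> k - 1" using that by linarith
    from eps_pos[OF this] show ?thesis using t_ge[of k] that by (simp add: P_def)
  qed
  have eps_prev: "eps k \<le> eps (k - 1)" if "2 \<le> k" for k
  proof -
    have "1 \<le> k - 1" using that by linarith
    from eps_dec[OF this] show ?thesis using that by simp
  qed
  have P_lim: "filterlim P at_top sequentially"
  proof (rule filterlim_at_top_mono[OF large])
    show "\<forall>\<^sub>F k in sequentially. (t k)\<^sup>2 * eps k \<le> P k"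
      using eventually_ge_at_top[of 2]
      by eventually_elim (use eps_prev in \<open>auto simp: P_def intro: mult_left_mono\<close>)
  qed
  have invP: "(\<lambda>k. 1 / P k) \<longlonglongrightarrow> 0"
    using P_lim by (intro tendsto_divide_0[OF tendsto_const] filterlim_at_top_imp_at_infinity)
  \<comment> \<open>\<open>contraction_bounded\<close> with \<open>M = 0\<close> is applied to
    \<open>E v k - \<eta> / 2 * P k\<close>; the resulting constant is absorbed by the other half of
    \<open>\<eta> * P k\<close> because \<open>P\<close> tends to infinity.\<close>
  have energy_small: "\<forall>\<^sub>F k in sequentially. E v k < \<eta> * P k" if \<eta>: "\<eta> > 0" for \<eta>
  proof -
    \<comment> \<open>After division by \<open>T * eps k\<close>, with \<open>T = t (Suc k)\<close>,
      the contribution of the drop of \<open>eps\<close> becomes \<open>r k\<close>, and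
      \<open>q k\<close> bounds that of \<open>1 - \<theta> k\<close>.\<close>
    define r where "r k = t (Suc k) * (eps (k - 1) - eps k) / eps k" for k
    define q where "q k = 1 / ((t k)\<^sup>2 * eps k)" for k
    have r: "r \<longlonglongrightarrow> 0" unfolding r_def by (rule rate)
    have q: "q \<longlonglongrightarrow> 0" unfolding q_def
      using large by (intro tendsto_divide_0[OF tendsto_const] filterlim_at_top_imp_at_infinity)
    have "(\<lambda>k. \<eta> / 2 * (1 - r k) - (norm v)\<^sup>2 * (r k / 2 + q k / (2 * s)))
        \<longlonglongrightarrow> \<eta> / 2 * (1 - 0) - (norm v)\<^sup>2 * (0 / 2 + 0 / (2 * s))"
      using s_pos by (intro tendsto_intros r q) auto
    then have "\<forall>\<^sub>F k in sequentially.
        0 < \<eta> / 2 * (1 - r k) - (norm v)\<^sup>2 * (r k / 2 + q k / (2 * s))"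
      by (rule order_tendstoD) (use \<eta> in simp)
    then have "\<forall>\<^sub>F k in sequentially. 0 \<le> \<theta> k \<and> \<theta> k \<le> 1 \<and>
        E v (Suc k) - \<eta> / 2 * P (Suc k) \<le> \<theta> k * (E v k - \<eta> / 2 * P k) + (1 - \<theta> k) * 0"
      using eventually_small_step
    proof eventually_elim
      case (elim k)
      define T where "T = t (Suc k)"
      have k: "2 \<le> k" "1 \<le> k" using elim by auto
      have ek: "0 < eps k" by (rule eps_pos[OF k(2)])
      have T: "1 \<le> T" using t_ge[of "Suc k"] by (simp add: T_def)
      have tk: "1 \<le> t k" "t k \<le> T" using t_ge[OF k(2)] t_mono[OF k(2)] by (auto simp: T_def)
      have rT: "T\<^sup>2 * (eps (k - 1) - eps k) = T * eps k * r k"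
        using ek by (simp add: r_def T_def power2_eq_square)
      have "(t k)\<^sup>2 \<le> T\<^sup>2" using tk by (intro power_mono) auto
      then have "((t k)\<^sup>2 - (T\<^sup>2 - T)) / (t k)\<^sup>2 \<le> T / (t k)\<^sup>2"
        by (intro divide_right_mono) auto
      moreover have "1 - \<theta> k = ((t k)\<^sup>2 - (T\<^sup>2 - T)) / (t k)\<^sup>2"
        using tk by (simp add: \<theta>_def T_def[symmetric] diff_divide_distrib)
      moreover have "T / (t k)\<^sup>2 = T * eps k * q k"
        using ek by (simp add: q_def)
      ultimately have "1 - \<theta> k \<le> T * eps k * q k" by simp
      then have "(1 - \<theta> k) / (2 * s) \<le> T * eps k * q k / (2 * s)"
        using s_pos by (intro divide_right_mono) auto
      then have "T\<^sup>2 * (eps (k - 1) - eps k) / 2 + (1 - \<theta> k) / (2 * s)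
          \<le> T * eps k * (r k / 2 + q k / (2 * s))"
        unfolding rT by (simp add: algebra_simps)
      then have "(norm v)\<^sup>2 * (T\<^sup>2 * (eps (k - 1) - eps k) / 2 + (1 - \<theta> k) / (2 * s))
          \<le> (norm v)\<^sup>2 * (T * eps k * (r k / 2 + q k / (2 * s)))"
        by (rule mult_left_mono) simp
      also have "\<dots> = T * eps k * ((norm v)\<^sup>2 * (r k / 2 + q k / (2 * s)))"
        by (simp add: mult_ac)
      also have "\<dots> \<le> T * eps k * (\<eta> / 2 * (1 - r k))"
        using elim T ek by (intro mult_left_mono) auto
      also have "\<dots> = \<eta> / 2 * (T * eps k - T * eps k * r k)"
        by (simp add: algebra_simps diff_divide_distrib)
      also have "\<dots> = \<eta> / 2 * (T * eps k - T\<^sup>2 * (eps (k - 1) - eps k))"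
        by (simp only: rT)
      also have "\<dots> \<le> \<eta> / 2 * (T * eps (k - 1) - T\<^sup>2 * (eps (k - 1) - eps k))"
        using \<eta> T eps_prev[OF k(1)] by (intro mult_left_mono diff_right_mono) auto
      also have "\<dots> = \<eta> / 2 * (P (Suc k) - \<theta> k * P k)"
      proof -
        have "\<theta> k * P k = (T\<^sup>2 - T) * eps (k - 1)"
          using tk by (simp add: P_def \<theta>_def T_def)
        then show ?thesis by (simp only:) (simp add: P_def T_def algebra_simps)
      qed
      finally have "(norm v)\<^sup>2 * ((t (Suc k))\<^sup>2 * (eps (k - 1) - eps k) / 2 + (1 - \<theta> k) / (2 * s))
          \<le> \<eta> / 2 * P (Suc k) - \<eta> / 2 * (\<theta> k * P k)"
        by (simp only: T_def right_diff_distrib)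
      moreover have "\<theta> k * (E v k - \<eta> / 2 * P k) = \<theta> k * E v k - \<eta> / 2 * (\<theta> k * P k)"
        by (simp add: algebra_simps)
      moreover have "E v (Suc k) \<le> \<theta> k * E v k
          + (norm v)\<^sup>2 * ((t (Suc k))\<^sup>2 * (eps (k - 1) - eps k) / 2 + (1 - \<theta> k) / (2 * s))"
        using energy_step[OF k(1) _ v] elim by blast
      ultimately have "E v (Suc k) - \<eta> / 2 * P (Suc k) \<le> \<theta> k * (E v k - \<eta> / 2 * P k)"
        by linarith
      then show ?case using theta_bounds[OF k(2)] by simp
    qed
    then obtain C where C: "\<forall>\<^sub>F k in sequentially. E v k - \<eta> / 2 * P k \<le> C"
      using contraction_bounded[where e = "\<lambda>k. E v k - \<eta> / 2 * P k" and M = 0] by blast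
    have "\<forall>\<^sub>F k in sequentially. 2 * C / \<eta> < P k"
      using P_lim by (simp add: filterlim_at_top_dense)
    with C show ?thesis
      by eventually_elim (use \<eta> in \<open>simp add: field_simps\<close>)
  qed

  \<comment> \<open>Limits of the rescaled Tikhonov objective and of the iterates\<close>
  define val where "val k = 2 / eps (k - 1) * (F (x k) - F xm) + (norm (x k))\<^sup>2" for k
  define zz where "zz k = (norm (z k - v))\<^sup>2 / (s * P k)" for k
  have Q_eq: "2 * E v k / P k = val k - (norm v)\<^sup>2 + zz k" if k: "2 \<le> k" for k
  proof -
    have "eps (k - 1) \<noteq> 0" "t k \<noteq> 0" using P_pos[OF k] by (auto simp: P_def)
    then show ?thesis
      using s_pos by (simp add: E_def val_def zz_def P_def Fv field_simps)
  qed
  have zz_nonneg: "0 \<le> zz k" if "2 \<le> k" for k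
    using P_pos[OF that] s_pos by (simp add: zz_def)
  \<comment> \<open>\<open>e\<close> is shifted by 1 and the weight paired with \<open>x k\<close>
    lags by 1, hence the offset 2.\<close>
  have k1: "e (k - 2) = eps (k - 1)" if "2 \<le> k" for k
  proof -
    have "Suc (k - 2) = k - 1" using that by simp
    then show ?thesis by (simp only: e_def)
  qed
  have m_lim': "(\<lambda>k. m (k - 2)) \<longlonglongrightarrow> (norm v)\<^sup>2"
    by (rule LIMSEQ_offset[of _ 2]) (use m_lim in simp)
  have val_ge: "m (k - 2) \<le> val k" if "2 \<le> k" for k
    using m_le[OF x_in_D[OF that], of "k - 2"] k1[OF that] by (simp add: val_def)
  have Q_lim: "(\<lambda>k. 2 * E v k / P k) \<longlonglongrightarrow> 0"
  proof (rule order_tendstoI)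
    fix b :: real assume "b < 0"
    have "(\<lambda>k. m (k - 2) - (norm v)\<^sup>2) \<longlonglongrightarrow> (norm v)\<^sup>2 - (norm v)\<^sup>2"
      by (intro tendsto_intros m_lim')
    then have "\<forall>\<^sub>F k in sequentially. b < m (k - 2) - (norm v)\<^sup>2"
      by (rule order_tendstoD) (use \<open>b < 0\<close> in simp)
    then show "\<forall>\<^sub>F k in sequentially. b < 2 * E v k / P k"
      using eventually_ge_at_top[of 2]
    proof eventually_elim
      case (elim k)
      then show ?case using val_ge[of k] zz_nonneg[of k] Q_eq[of k] by linarith
    qed
  next
    fix b :: real assume "0 < b"
    then have "\<forall>\<^sub>F k in sequentially. E v k < b / 2 * P k" by (intro energy_small) simp
    then show "\<forall>\<^sub>F k in sequentially. 2 * E v k / P k < b"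
      using eventually_ge_at_top[of 2]
      by eventually_elim (use P_pos in \<open>simp add: pos_divide_less_eq\<close>)
  qed
  have val_lim: "(\<lambda>k. val k - (norm v)\<^sup>2) \<longlonglongrightarrow> 0"
  proof (rule tendsto_sandwich[OF _ _ _ Q_lim])
    show "(\<lambda>k. m (k - 2) - (norm v)\<^sup>2) \<longlonglongrightarrow> 0"
      using m_lim' by (simp add: LIM_zero_iff)
    show "\<forall>\<^sub>F k in sequentially. m (k - 2) - (norm v)\<^sup>2 \<le> val k - (norm v)\<^sup>2"
      using eventually_ge_at_top[of 2] by eventually_elim (use val_ge in simp)
    show "\<forall>\<^sub>F k in sequentially. val k - (norm v)\<^sup>2 \<le> 2 * E v k / P k"
      using eventually_ge_at_top[of 2] by eventually_elim (use Q_eq zz_nonneg in simp)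
  qed
  have "(\<lambda>k. 2 * E v k / P k - (val k - (norm v)\<^sup>2)) \<longlonglongrightarrow> 0 - 0"
    by (intro tendsto_intros Q_lim val_lim)
  moreover have "\<forall>\<^sub>F k in sequentially. 2 * E v k / P k - (val k - (norm v)\<^sup>2) = zz k"
    using eventually_ge_at_top[of 2] by eventually_elim (use Q_eq in simp)
  ultimately have zz_lim: "zz \<longlonglongrightarrow> 0"
    using tendsto_cong by force
  \<comment> \<open>The strong convexity estimate \<open>mid\<close> at \<open>x k\<close>: the
    objective \<open>val k\<close> and the lower bound \<open>m (k - 2)\<close> both tend to
    \<open>(norm v)\<^sup>2\<close>.\<close>
  have x_sq: "(\<lambda>k. (norm (x k - v))\<^sup>2) \<longlonglongrightarrow> 0"
  proof (rule tendsto_sandwich[OF _ _ tendsto_const])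
    have "(\<lambda>k. 2 * (val k - (norm v)\<^sup>2) + 4 * ((norm v)\<^sup>2 - m (k - 2))) \<longlonglongrightarrow> 2 * 0 + 4 * ((norm v)\<^sup>2 - (norm v)\<^sup>2)"
      by (intro tendsto_intros val_lim m_lim')
    then show "(\<lambda>k. 2 * (val k - (norm v)\<^sup>2) + 4 * ((norm v)\<^sup>2 - m (k - 2))) \<longlonglongrightarrow> 0" by simp
    show "\<forall>\<^sub>F k in sequentially. (norm (x k - v))\<^sup>2 \<le> 2 * (val k - (norm v)\<^sup>2) + 4 * ((norm v)\<^sup>2 - m (k - 2))"
      using eventually_ge_at_top[of 2]
    proof eventually_elim
      case (elim k)
      show ?case
        using mid[OF x_in_D[OF elim], of "k - 2"] k1[OF elim] by (simp add: val_def)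
    qed
  qed simp
  then have x_norm: "(\<lambda>k. norm (x k - v)) \<longlonglongrightarrow> 0"
    using tendsto_real_sqrt[OF x_sq] by simp
  then have x_lim: "x \<longlonglongrightarrow> v"
    by (simp add: LIM_zero_iff tendsto_norm_zero_iff)
  have x_prev: "(\<lambda>k. (norm (x (k - 1) - v))\<^sup>2) \<longlonglongrightarrow> 0"
    by (rule LIMSEQ_offset[of _ 1]) (use x_sq in simp)

  \<comment> \<open>Velocity and objective gap\<close>
  have vel: "(\<lambda>k. (norm (x k - x (k - 1)))\<^sup>2 / eps (k - 1)) \<longlonglongrightarrow> 0"
  proof (rule tendsto_sandwich[OF _ _ tendsto_const])
    have "(\<lambda>k. 2 * s * zz k + 2 * ((norm (x (k - 1) - v))\<^sup>2 * (1 / P k))) \<longlonglongrightarrow> 2 * s * 0 + 2 * (0 * 0)"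
      by (intro tendsto_intros zz_lim x_prev invP)
    then show "(\<lambda>k. 2 * s * zz k + 2 * ((norm (x (k - 1) - v))\<^sup>2 * (1 / P k))) \<longlonglongrightarrow> 0" by simp
    show "\<forall>\<^sub>F k in sequentially. (norm (x k - x (k - 1)))\<^sup>2 / eps (k - 1)
        \<le> 2 * s * zz k + 2 * ((norm (x (k - 1) - v))\<^sup>2 * (1 / P k))"
      using eventually_ge_at_top[of 2]
    proof eventually_elim
      case (elim k)
      have tk: "t k \<noteq> 0" using t_ge[of k] elim by simp
      \<comment> \<open>The definition of \<open>z\<close> solved for the velocity; after squaring
        and division by \<open>P k\<close> the first part contributes a multiple of
        \<open>zz k\<close>, the second a null sequence times \<open>1 / P k\<close>.\<close>
      have "t k *\<^sub>R (x k - x (k - 1)) = (z k - v) - (x (k - 1) - v)" by (simp add: z_def)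
      then have "(t k)\<^sup>2 * (norm (x k - x (k - 1)))\<^sup>2 = (norm ((z k - v) - (x (k - 1) - v)))\<^sup>2"
        by (metis norm_scaleR power2_abs power_mult_distrib)
      also have "\<dots> \<le> 2 * (norm (z k - v))\<^sup>2 + 2 * (norm (x (k - 1) - v))\<^sup>2"
      proof -
        have "(norm ((z k - v) - (x (k - 1) - v)))\<^sup>2 \<le> (norm (z k - v) + norm (x (k - 1) - v))\<^sup>2"
          by (intro power_mono norm_triangle_ineq4) simp
        also have "\<dots> \<le> 2 * (norm (z k - v))\<^sup>2 + 2 * (norm (x (k - 1) - v))\<^sup>2"
          using sum_squares_bound[of "norm (z k - v)" "norm (x (k - 1) - v)"]
          by (simp add: power2_sum)
        finally show ?thesis .
      qed
      finally have "(t k)\<^sup>2 * (norm (x k - x (k - 1)))\<^sup>2 / P k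
          \<le> (2 * (norm (z k - v))\<^sup>2 + 2 * (norm (x (k - 1) - v))\<^sup>2) / P k"
        using P_pos[OF elim] by (intro divide_right_mono) auto
      then show ?case
        using s_pos tk by (simp add: zz_def add_divide_distrib) (simp add: P_def)
    qed
    show "\<forall>\<^sub>F k in sequentially. 0 \<le> (norm (x k - x (k - 1)))\<^sup>2 / eps (k - 1)"
      using eventually_ge_at_top[of 2]
    proof eventually_elim
      case (elim k)
      have "1 \<le> k - 1" using elim by linarith
      from eps_pos[OF this] show ?case by simp
    qed
  qed
  have "\<forall>\<^sub>F k in sequentially. val k - (norm v)\<^sup>2 < 1"
    using val_lim by (rule order_tendstoD) simp
  then have gap: "\<forall>\<^sub>F k in sequentially. F (x k) - F xm \<le> ((norm v)\<^sup>2 + 1) * eps (k - 1)"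
    using eventually_ge_at_top[of 2]
  proof eventually_elim
    case (elim k)
    have "1 \<le> k - 1" using elim by linarith
    from eps_pos[OF this] have ek: "0 < eps (k - 1)" .
    have "2 / eps (k - 1) * (F (x k) - F xm) \<le> (norm v)\<^sup>2 + 1"
      using elim zero_le_power2[of "norm (x k)"] unfolding val_def by linarith
    then have "2 * (F (x k) - F xm) \<le> ((norm v)\<^sup>2 + 1) * eps (k - 1)"
      using ek by (simp add: field_simps)
    moreover have "F (x k) - F xm \<le> 2 * (F (x k) - F xm)"
      using F_ge_min[OF x_in_D[OF elim(2)]] by simp
    ultimately show ?case by (rule order_trans[rotated])
  qed
  show ?thesis by (rule that[OF v Fv norm_min unique x_lim vel gap])
qed

end

section \<open>Asymptotics of the parameters\<close>

text \<open>The mean value theorem; since \<open>r \<ge> 1\<close>, the derivative of the power is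
  largest at the right end \<open>b\<close>.\<close>

lemma powr_diff_le:
  fixes r u b :: real
  assumes "1 \<le> r" "0 < u" "u \<le> b"
  shows "b powr r - u powr r \<le> r * (b - u) * b powr (r - 1)"
proof (cases "u = b")
  case False
  then have ub: "u < b" using assms by simp
  have "\<exists>\<xi>. \<xi> > u \<and> \<xi> < b \<and> b powr r - u powr r = (b - u) * (r * \<xi> powr (r - 1))"
    using assms by (intro MVT2[OF ub] has_real_derivative_powr) auto
  then obtain \<xi> where \<xi>: "u < \<xi>" "\<xi> < b"
    and eq: "b powr r - u powr r = (b - u) * (r * \<xi> powr (r - 1))" by blast
  have "\<xi> powr (r - 1) \<le> b powr (r - 1)"
    using \<xi> assms by (intro powr_mono2) auto
  then have "(b - u) * (r * \<xi> powr (r - 1)) \<le> (b - u) * (r * b powr (r - 1))"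
    using assms by (intro mult_left_mono) auto
  then show ?thesis unfolding eq by (simp add: mult_ac)
qed simp

text \<open>
  The index \<open>0\<close> carries junk: \<open>t 0\<close> may be a power of a negative number, and \<open>eps 0 = c / 0 = 0\<close>.
\<close>

locale step_parameters =
  fixes a q c p :: real
  assumes q: "1 / 2 \<le> q" "q \<le> 1" and a: "0 < a" "a \<le> 1 / (2 * q)" and c: "0 < c" and p: "0 < p"
begin

definition t :: "nat \<Rightarrow> real" where "t k = (a * real k + 1 - a) powr q"

definition eps :: "nat \<Rightarrow> real" where "eps k = c / real k powr p"

lemma t_Suc: "t (Suc k) = (a * real k + 1) powr q"
  by (simp add: t_def algebra_simps)

lemma base_ge: "1 \<le> k \<Longrightarrow> 1 \<le> a * real k + 1 - a"
  using mult_left_mono[of 1 "real k" a] a by simp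

lemma t_ge: "1 \<le> k \<Longrightarrow> 1 \<le> t k"
  unfolding t_def using base_ge[of k] q by (intro ge_one_powr_ge_zero) auto

lemma t_mono: "1 \<le> k \<Longrightarrow> t k \<le> t (Suc k)"
  unfolding t_Suc unfolding t_def 
  by (intro powr_mono2) (use base_ge[of k] a q in linarith)+

text \<open>\<open>powr_diff_le\<close> with exponent \<open>2 * q\<close>, which is at least 1,
  over a step of length \<open>a\<close>. The factor \<open>t (Suc k)\<close> is split off for
  comparison with the linear term in \<open>t_growth\<close>.\<close>

lemma t_sq_diff:
  assumes k: "1 \<le> k"
  shows "(t (Suc k))\<^sup>2 - (t k)\<^sup>2 \<le> t (Suc k) * (2 * q * a * (a * real k + 1) powr (q - 1))"
proof -
  define b where "b = a * real k + 1"
  have b: "1 \<le> b - a" "1 \<le> b" using base_ge[OF k] a by (auto simp: b_def)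
  have "(t (Suc k))\<^sup>2 - (t k)\<^sup>2 = b powr (2 * q) - (b - a) powr (2 * q)"
    unfolding t_Suc unfolding t_def b_def using b
    by (simp add: powr_power algebra_simps b_def)
  also have "\<dots> \<le> 2 * q * (b - (b - a)) * b powr (2 * q - 1)"
    using b q a by (intro powr_diff_le) auto
  also have "b powr (2 * q - 1) = b powr q * b powr (q - 1)"
    by (simp flip: powr_add)
  finally show ?thesis by (simp add: t_Suc b_def mult_ac)
qed

text \<open>The bound \<open>a \<le> 1 / (2 * q)\<close> keeps the increment of the squares at most
  \<open>t (Suc k)\<close>.\<close>

lemma t_growth:
  assumes k: "1 \<le> k"
  shows "(t (Suc k))\<^sup>2 - t (Suc k) \<le> (t k)\<^sup>2"
proof -
  have "(a * real k + 1) powr (q - 1) \<le> 1"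
    using powr_mono[of "q - 1" 0 "a * real k + 1"] q base_ge[OF k] a by simp
  moreover have "2 * q * a \<le> 1" using a q by (simp add: field_simps)
  ultimately have "2 * q * a * (a * real k + 1) powr (q - 1) \<le> 1"
    by (rule mult_le_one[rotated 2]) simp
  then have "t (Suc k) * (2 * q * a * (a * real k + 1) powr (q - 1)) \<le> t (Suc k) * 1"
    using t_ge[of "Suc k"] by (intro mult_left_mono) auto
  then show ?thesis using t_sq_diff[OF k] by simp
qed

lemma eps_pos: "1 \<le> k \<Longrightarrow> 0 < eps k"
  using c by (simp add: eps_def)

lemma eps_dec: "1 \<le> k \<Longrightarrow> eps (Suc k) \<le> eps k"
  unfolding eps_def using c p by (intro divide_left_mono powr_mono2) auto

lemma eps_lim: "eps \<longlonglongrightarrow> 0"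
  unfolding eps_def using c p by real_asymp

text \<open>Removes the truncated subtraction on naturals, so that asymptotic expansions in
  \<open>real k\<close> apply.\<close>

lemma eventually_eps_pred: "\<forall>\<^sub>F k in sequentially. eps (k - 1) = c / (real k - 1) powr p"
  using eventually_ge_at_top[of 1] by eventually_elim (simp add: eps_def of_nat_diff)

lemma eps_pred_bigo: "(\<lambda>k. eps (k - 1)) \<in> O(\<lambda>k. real k powr (- p))"
proof -
  have "(\<lambda>k. c / (real k - 1) powr p) \<in> O(\<lambda>k. real k powr (- p))"
    using c p by real_asymp
  then show ?thesis
    using landau_o.big.in_cong[OF eventually_eps_pred] by blast
qed

text \<open>\<open>t (Suc k)\<close> has order \<open>k powr q\<close> and the relative decrease of
  \<open>eps\<close> has order \<open>1 / k\<close>, so the product has order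
  \<open>k powr (q - 1)\<close>.\<close>

lemma rate_lim:
  assumes "q < 1"
  shows "(\<lambda>k. t (Suc k) * (eps (k - 1) - eps k) / eps k) \<longlonglongrightarrow> 0"
proof -
  have "0 < q" using q by simp
  then have "(\<lambda>k. (a * real k + 1) powr q * (c / (real k - 1) powr p - c / real k powr p)
      / (c / real k powr p)) \<longlonglongrightarrow> 0"
    using assms a(1) c p by real_asymp
  moreover have ev: "\<forall>\<^sub>F k in sequentially. t (Suc k) * (eps (k - 1) - eps k) / eps k
      = (a * real k + 1) powr q * (c / (real k - 1) powr p - c / real k powr p) / (c / real k powr p)"
    using eventually_eps_pred
  proof eventually_elim
    case (elim k)
    show ?case unfolding elim t_Suc by (simp add: eps_def)
  qed
  ultimately show ?thesis by (simp only: tendsto_cong[OF ev])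
qed

lemma t_sq_eps_lim:
  assumes "p < 2 * q"
  shows "filterlim (\<lambda>k. (t k)\<^sup>2 * eps k) at_top sequentially"
  unfolding t_def eps_def using assms a(1) c p q(1) by real_asymp

lemma inverse_t_sq_bigo: "(\<lambda>k. 1 / (t k)\<^sup>2) \<in> O(\<lambda>k. real k powr (- (2 * q)))"
proof -
  have "0 < q" using q by simp
  then show ?thesis unfolding t_def using a(1) by real_asymp
qed

lemma powr_bigo_mono:
  fixes u v :: real
  assumes "u \<le> v"
  shows "(\<lambda>k. real k powr u) \<in> O(\<lambda>k. real k powr v)"
proof (rule landau_o.big_mono)
  show "\<forall>\<^sub>F k in sequentially. norm (real k powr u) \<le> norm (real k powr v)"
    using eventually_ge_at_top[of 1] by eventually_elim (use assms in \<open>auto intro: powr_mono\<close>)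
qed

text \<open>Over the denominator \<open>(t k)\<^sup>2\<close> the numerator on the right is at least
  \<open>d * t (Suc k)\<close> by \<open>t_sq_diff\<close>, and the denominator is at most the
  square of \<open>t (Suc k)\<close>.\<close>

lemma one_minus_theta_ge:
  assumes k: "1 \<le> k" and d: "d \<le> 1 - 2 * q * a * (a * real k + 1) powr (q - 1)" and d0: "0 \<le> d"
  shows "d / t (Suc k) \<le> 1 - ((t (Suc k))\<^sup>2 - t (Suc k)) / (t k)\<^sup>2"
proof -
  have tk: "1 \<le> t k" "t k \<le> t (Suc k)" using t_ge[OF k] t_mono[OF k] by auto
  have sq: "(t k)\<^sup>2 \<le> (t (Suc k))\<^sup>2" using tk by (intro power_mono) auto
  have "d / t (Suc k) = d * t (Suc k) / (t (Suc k))\<^sup>2"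
    using tk by (simp add: power2_eq_square)
  also have "\<dots> \<le> d * t (Suc k) / (t k)\<^sup>2"
    using tk d0 sq by (intro divide_left_mono mult_nonneg_nonneg mult_pos_pos zero_less_power) auto
  also have "\<dots> \<le> ((t k)\<^sup>2 - ((t (Suc k))\<^sup>2 - t (Suc k))) / (t k)\<^sup>2"
  proof (rule divide_right_mono)
    have "t (Suc k) * d \<le> t (Suc k) * (1 - 2 * q * a * (a * real k + 1) powr (q - 1))"
      using d tk by (intro mult_left_mono) auto
    then show "d * t (Suc k) \<le> (t k)\<^sup>2 - ((t (Suc k))\<^sup>2 - t (Suc k))"
      using t_sq_diff[OF k] by (simp add: algebra_simps)
  qed simp
  also have "\<dots> = 1 - ((t (Suc k))\<^sup>2 - t (Suc k)) / (t k)\<^sup>2"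
    using tk by (simp add: diff_divide_distrib)
  finally show ?thesis .
qed

text \<open>The contraction factor falls short of 1 by at least \<open>d / t (Suc k)\<close>, so it
  suffices that \<open>t (Suc k) ^ 3\<close> times the drop of \<open>eps\<close> is bounded. Its
  exponent \<open>3 * q - p - 1\<close> is nonpositive because \<open>p \<ge> 2 * q\<close> and
  \<open>q \<le> 1\<close>.\<close>

lemma perturbation_le_contraction:
  assumes p2: "2 * q \<le> p" and ne: "\<not> (a = 1 / 2 \<and> q = 1)"
  shows "\<exists>B. \<forall>\<^sub>F k in sequentially. (t (Suc k))\<^sup>2 * (eps (k - 1) - eps k)
    \<le> B * (1 - ((t (Suc k))\<^sup>2 - t (Suc k)) / (t k)\<^sup>2)"
proof -
  have q0: "0 < q" using q by simp
  \<comment> \<open>The witness is 1/2 for \<open>q < 1\<close>, where the power tends to 0, and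
    \<open>1 - 2 * a\<close> for \<open>q = 1\<close>, where excluding \<open>a = 1 / 2\<close>
    makes it positive.\<close>
  have "\<exists>d>0. \<forall>\<^sub>F k in sequentially. d \<le> 1 - 2 * q * a * (a * real k + 1) powr (q - 1)"
  proof (cases "q < 1")
    case True
    then have "(\<lambda>k. (a * real k + 1) powr (q - 1)) \<longlonglongrightarrow> 0" using a(1) by real_asymp
    then have "(\<lambda>k. 1 - 2 * q * a * (a * real k + 1) powr (q - 1)) \<longlonglongrightarrow> 1 - 2 * q * a * 0"
      by (intro tendsto_intros)
    then have "\<forall>\<^sub>F k in sequentially. 1 / 2 < 1 - 2 * q * a * (a * real k + 1) powr (q - 1)"
      by (rule order_tendstoD) simp
    then have "\<forall>\<^sub>F k in sequentially. 1 / 2 \<le> 1 - 2 * q * a * (a * real k + 1) powr (q - 1)"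
      by eventually_elim simp
    then show ?thesis by (intro exI[of _ "1 / 2"]) simp
  next
    case False
    then have "q = 1" using q by simp
    then have "0 < 1 - 2 * a" using a ne by auto
    moreover have "(a * real k + 1) powr (q - 1) = 1" for k
      using \<open>q = 1\<close> a by (simp add: add_nonneg_pos less_imp_neq[THEN not_sym])
    ultimately show ?thesis using \<open>q = 1\<close> by (intro exI[of _ "1 - 2 * a"]) simp
  qed
  then obtain d where d: "0 < d"
    "\<forall>\<^sub>F k in sequentially. d \<le> 1 - 2 * q * a * (a * real k + 1) powr (q - 1)" by blast
  have "(\<lambda>k. ((a * real k + 1) powr q) ^ 3 * (c / (real k - 1) powr p - c / real k powr p))
      \<in> O(\<lambda>k. real k powr (3 * q - p - 1))"
    using q0 a(1) c p by real_asymp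
  also have "(\<lambda>k. real k powr (3 * q - p - 1)) \<in> O(\<lambda>k. real k powr 0)"
    using p2 q by (intro powr_bigo_mono) simp
  finally obtain C where "\<forall>\<^sub>F k in sequentially.
      norm (((a * real k + 1) powr q) ^ 3 * (c / (real k - 1) powr p - c / real k powr p))
        \<le> C * norm (real k powr 0)"
    using landau_o.bigE by blast
  then have "\<forall>\<^sub>F k in sequentially. (t (Suc k))\<^sup>2 * (eps (k - 1) - eps k)
      \<le> \<bar>C\<bar> / d * (1 - ((t (Suc k))\<^sup>2 - t (Suc k)) / (t k)\<^sup>2)"
    using d(2) eventually_eps_pred eventually_ge_at_top[of 1]
  proof eventually_elim
    case (elim k)
    have T: "1 \<le> t (Suc k)" by (rule t_ge) simp
    have "(t (Suc k)) ^ 3 * (eps (k - 1) - eps k) \<le> \<bar>C\<bar>"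
      using elim(1) elim(4) unfolding elim(3) unfolding t_Suc eps_def[of k] by simp
    then have "(t (Suc k))\<^sup>2 * (eps (k - 1) - eps k) \<le> \<bar>C\<bar> / t (Suc k)"
      using T by (simp add: pos_le_divide_eq power2_eq_square power3_eq_cube mult_ac)
    also have "\<dots> = \<bar>C\<bar> / d * (d / t (Suc k))" using d(1) by simp
    also have "\<dots> \<le> \<bar>C\<bar> / d * (1 - ((t (Suc k))\<^sup>2 - t (Suc k)) / (t k)\<^sup>2)"
      using one_minus_theta_ge[OF elim(4) elim(2)] d(1) by (intro mult_left_mono) auto
    finally show ?case .
  qed
  then show ?thesis by blast
qed

text \<open>Here the contraction factor is exactly \<open>1 - 1 / (real k + 1)\<^sup>2\<close>, and
  the first sequence has order \<open>k powr (1 - p)\<close>, which is summable because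
  \<open>p > 2\<close>.\<close>

lemma critical_summable:
  assumes p2: "2 < p" and crit: "a = 1 / 2" "q = 1"
  shows "summable (\<lambda>k. (t (Suc k))\<^sup>2 * (eps (k - 1) - eps k))"
    and "summable (\<lambda>k. 1 - ((t (Suc k))\<^sup>2 - t (Suc k)) / (t k)\<^sup>2)"
proof -
  have "(\<lambda>k. ((1 / 2 * real k + 1) powr 1)\<^sup>2 * (c / (real k - 1) powr p - c / real k powr p))
      \<in> O(\<lambda>k. real k powr (1 - p))"
    using c p by real_asymp
  moreover have ev: "\<forall>\<^sub>F k in sequentially. (t (Suc k))\<^sup>2 * (eps (k - 1) - eps k)
      = ((1 / 2 * real k + 1) powr 1)\<^sup>2 * (c / (real k - 1) powr p - c / real k powr p)"
    using eventually_eps_pred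
  proof eventually_elim
    case (elim k)
    show ?case unfolding elim t_Suc by (simp add: eps_def crit)
  qed
  ultimately have "(\<lambda>k. (t (Suc k))\<^sup>2 * (eps (k - 1) - eps k)) \<in> O(\<lambda>k. real k powr (1 - p))"
    by (simp only: landau_o.big.in_cong[OF ev])
  then show "summable (\<lambda>k. (t (Suc k))\<^sup>2 * (eps (k - 1) - eps k))"
    by (rule summable_comparison_test_bigo[rotated]) (use p2 in \<open>simp add: summable_real_powr_iff\<close>)
  have "1 - ((t (Suc k))\<^sup>2 - t (Suc k)) / (t k)\<^sup>2 = 1 / (real k + 1)\<^sup>2" for k
  proof -
    have "t (Suc k) = real k / 2 + 1" "t k = (real k + 1) / 2"
      unfolding t_def unfolding crit by (simp_all add: field_simps)
    then show ?thesis by (simp only:) (simp add: divide_simps power2_eq_square, simp add: algebra_simps)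
  qed
  moreover have "(\<lambda>k. 1 / (real k + 1)\<^sup>2) \<in> O(\<lambda>k. real k powr (- 2))"
    by real_asymp
  ultimately have "(\<lambda>k. 1 - ((t (Suc k))\<^sup>2 - t (Suc k)) / (t k)\<^sup>2) \<in> O(\<lambda>k. real k powr (- 2))"
    by simp
  then show "summable (\<lambda>k. 1 - ((t (Suc k))\<^sup>2 - t (Suc k)) / (t k)\<^sup>2)"
    by (rule summable_comparison_test_bigo[rotated]) (simp add: summable_real_powr_iff)
qed

lemma inertia_lim: "(\<lambda>k. (t (Suc k) - 1) * (t k - 1) / (t k)\<^sup>2) \<longlonglongrightarrow> 1"
proof -
  have q0: "0 < q" using q by simp
  have "(\<lambda>k. ((a * real k + 1) powr q - 1) / (a * real k + 1 - a) powr q) \<longlonglongrightarrow> 1"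
    "(\<lambda>k. ((a * real k + 1 - a) powr q - 1) / (a * real k + 1 - a) powr q) \<longlonglongrightarrow> 1"
    using q0 a(1) by real_asymp+
  from tendsto_mult[OF this] show ?thesis
    unfolding t_Suc unfolding t_def by (simp add: power2_eq_square)
qed

text \<open>Monotonicity of \<open>t\<close> and \<open>t_growth\<close> put the numerator between 0
  and \<open>t (Suc k)\<close>, so the coefficient is at most \<open>1 / (t k)\<^sup>2\<close>, of
  order \<open>k powr (- 2 * q)\<close>, and \<open>p / 2 < 2 * q\<close>.\<close>

lemma shrinkage_lim:
  assumes p2: "p < 2 * q"
  shows "(\<lambda>k. \<bar>(- ((t (Suc k))\<^sup>2) + t (Suc k) + (t k)\<^sup>2) / ((t k)\<^sup>2 * t (Suc k))\<bar> / real k powr (- p / 2))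
    \<longlonglongrightarrow> 0"
proof (rule tendsto_sandwich[OF _ _ tendsto_const])
  have "0 < q" "p / 2 < 2 * q" using p2 q p by auto
  then show "(\<lambda>k. 1 / (t k)\<^sup>2 / real k powr (- p / 2)) \<longlonglongrightarrow> 0"
    unfolding t_def using a(1) p by real_asymp
  show "\<forall>\<^sub>F k in sequentially.
      \<bar>(- ((t (Suc k))\<^sup>2) + t (Suc k) + (t k)\<^sup>2) / ((t k)\<^sup>2 * t (Suc k))\<bar> / real k powr (- p / 2)
        \<le> 1 / (t k)\<^sup>2 / real k powr (- p / 2)"
    using eventually_ge_at_top[of 1]
  proof eventually_elim
    case (elim k)
    have tk: "1 \<le> t k" "t k \<le> t (Suc k)" using t_ge[OF elim] t_mono[OF elim] by auto
    then have "(t k)\<^sup>2 \<le> (t (Suc k))\<^sup>2" by (intro power_mono) auto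
    then have "\<bar>- ((t (Suc k))\<^sup>2) + t (Suc k) + (t k)\<^sup>2\<bar> \<le> t (Suc k)"
      using t_growth[OF elim] by simp
    then have "\<bar>- ((t (Suc k))\<^sup>2) + t (Suc k) + (t k)\<^sup>2\<bar> / ((t k)\<^sup>2 * t (Suc k))
        \<le> t (Suc k) / ((t k)\<^sup>2 * t (Suc k))"
      using tk by (intro divide_right_mono) auto
    also have "\<dots> = 1 / (t k)\<^sup>2" using tk by simp
    finally have "\<bar>(- ((t (Suc k))\<^sup>2) + t (Suc k) + (t k)\<^sup>2) / ((t k)\<^sup>2 * t (Suc k))\<bar> \<le> 1 / (t k)\<^sup>2"
      using tk by (simp add: abs_mult)
    then show ?case by (rule divide_right_mono) simp
  qed
qed simp_all

lemma eps_shift_lims: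
  shows "(\<lambda>k. eps k / real (Suc k) powr (- p)) \<longlonglongrightarrow> c"
    and "(\<lambda>k. eps k / real (Suc k) powr (- p / 2)) \<longlonglongrightarrow> 0"
    and "(\<lambda>k. real k powr (- p / 2) / real (Suc k) powr (- p / 2)) \<longlonglongrightarrow> 1"
  unfolding eps_def using c p by real_asymp+

end

section \<open>Extended-real-valued functions\<close>

lemma proper_fun_ereal:
  assumes "proper_fun f" "f x \<noteq> \<infinity>"
  shows "f x = ereal (real_of_ereal (f x))"
  using assms unfolding proper_fun_def by (cases "f x") auto

lemma convex_fun_imp_convex_on:
  assumes proper: "proper_fun f" and conv: "convex_fun f"
  shows "convex_on {x. f x \<noteq> \<infinity>} (\<lambda>x. real_of_ereal (f x))"
proof -
  have le: "f ((1 - t) *\<^sub>R x + t *\<^sub>R y) \<le> ereal ((1 - t) * real_of_ereal (f x) + t * real_of_ereal (f y))"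
    if "0 \<le> t" "t \<le> 1" "f x \<noteq> \<infinity>" "f y \<noteq> \<infinity>" for t x y
  proof -
    have "f ((1 - t) *\<^sub>R x + t *\<^sub>R y) \<le> ereal (1 - t) * f x + ereal t * f y"
      using conv that unfolding convex_fun_def by auto
    then show ?thesis
      using proper_fun_ereal[OF proper that(3)] proper_fun_ereal[OF proper that(4)]
      by (metis plus_ereal.simps(1) times_ereal.simps(1))
  qed
  show ?thesis
  proof (rule convex_onI)
    show "convex {x. f x \<noteq> \<infinity>}"
      unfolding convex_alt using le by fastforce
    fix t :: real and x y
    assume *: "0 < t" "t < 1" "x \<in> {x. f x \<noteq> \<infinity>}" "y \<in> {x. f x \<noteq> \<infinity>}"
    then have l: "f ((1 - t) *\<^sub>R x + t *\<^sub>R y) \<le> ereal ((1 - t) * real_of_ereal (f x) + t * real_of_ereal (f y))"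
      by (intro le) auto
    then have "f ((1 - t) *\<^sub>R x + t *\<^sub>R y) \<noteq> \<infinity>" by auto
    from proper_fun_ereal[OF proper this] l
    show "real_of_ereal (f ((1 - t) *\<^sub>R x + t *\<^sub>R y)) \<le> (1 - t) * real_of_ereal (f x) + t * real_of_ereal (f y)"
      by (metis ereal_less_eq(3))
  qed
qed

lemma lsc_fun_closed_sublevel:
  assumes lsc: "lsc_fun f"
  shows "closed {x. f x \<le> b}"
proof -
  have "open {x. b < f x}"
  proof (subst open_subopen, safe)
    fix x assume x: "b < f x"
    then have "b < Liminf (at x) f" using lsc unfolding lsc_fun_def by (meson less_le_trans)
    then have "\<forall>\<^sub>F y in at x. b < f y" by (rule less_LiminfD)
    \<comment> \<open>The filter \<open>at x\<close> leaves out \<open>x\<close> itself, where the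
      strict inequality holds by assumption.\<close>
    then have "\<forall>\<^sub>F y in nhds x. b < f y"
      using x by (simp add: eventually_nhds_conv_at)
    then show "\<exists>T. open T \<and> x \<in> T \<and> T \<subseteq> {x. b < f x}"
      unfolding eventually_nhds by blast
  qed
  moreover have "- {x. f x \<le> b} = {x. b < f x}" by auto
  ultimately show ?thesis by (simp add: closed_def)
qed

lemma proper_sublevel_real:
  assumes "proper_fun f"
  shows "{x \<in> {x. f x \<noteq> \<infinity>}. real_of_ereal (f x) \<le> b} = {x. f x \<le> ereal b}"
proof -
  have "f x \<noteq> \<infinity> \<and> real_of_ereal (f x) \<le> b \<longleftrightarrow> f x \<le> ereal b" for x
    using assms unfolding proper_fun_def by (cases "f x") auto
  then show ?thesis by simp
qed

text \<open>\<open>prox\<close> is defined by choice, so it is a minimizer as soon as one exists;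
  \<open>p\<close> is such a witness.\<close>

lemma prox_minimizes:
  assumes proper: "proper_fun f" and p: "f p \<noteq> \<infinity>"
    and min: "\<And>z. f z \<noteq> \<infinity> \<Longrightarrow>
      real_of_ereal (f p) + 1 / (2 * s) * (norm (p - u))\<^sup>2 \<le> real_of_ereal (f z) + 1 / (2 * s) * (norm (z - u))\<^sup>2"
  shows "f (prox s f u) \<noteq> \<infinity>"
    and "f z \<noteq> \<infinity> \<Longrightarrow> real_of_ereal (f (prox s f u)) + 1 / (2 * s) * (norm (prox s f u - u))\<^sup>2
      \<le> real_of_ereal (f z) + 1 / (2 * s) * (norm (z - u))\<^sup>2"
proof -
  define h where "h y = f y + ereal (1 / (2 * s) * (norm (y - u))\<^sup>2)" for y
  have fin: "h y = ereal (real_of_ereal (f y) + 1 / (2 * s) * (norm (y - u))\<^sup>2)" if "f y \<noteq> \<infinity>" for y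
    unfolding h_def by (subst proper_fun_ereal[OF proper that]) simp
  have inf: "h y = \<infinity>" if "f y = \<infinity>" for y
    using that by (simp add: h_def)
  have "h p \<le> h y" for y
    using min[of y] fin[OF p] fin[of y] inf[of y] by (cases "f y = \<infinity>") auto
  then have "is_arg_min h (\<lambda>_. True) p"
    by (auto simp: is_arg_min_def not_less)
  then have "is_arg_min h (\<lambda>_. True) (arg_min h (\<lambda>_. True))"
    unfolding arg_min_def by (rule someI)
  moreover have "arg_min h (\<lambda>_. True) = prox s f u"
    by (simp add: prox_def h_def[abs_def])
  ultimately have le: "h (prox s f u) \<le> h y" for y
    by (auto simp: is_arg_min_def not_less)
  show ne: "f (prox s f u) \<noteq> \<infinity>"
    using le[of p] inf[of "prox s f u"] fin[OF p] by auto
  show "real_of_ereal (f (prox s f u)) + 1 / (2 * s) * (norm (prox s f u - u))\<^sup>2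
      \<le> real_of_ereal (f z) + 1 / (2 * s) * (norm (z - u))\<^sup>2" if "f z \<noteq> \<infinity>"
    using le[of z] unfolding fin[OF ne] fin[OF that] by simp
qed

text \<open>The coefficients of \<open>X\<close> and \<open>Y\<close> agree on both sides. With
  \<open>T = t (Suc k)\<close> and \<open>\<tau> = t k\<close> the left side is the extrapolation of
  the algorithm, the right side its form as a shrunk Nesterov step.\<close>

lemma inertial_extrapolation_eq:
  fixes X Y :: "'a::real_vector" and T \<tau> :: real
  assumes "T \<noteq> 0" "\<tau> \<noteq> 0"
  shows "X + ((T - 1) * (\<tau> - 1) / \<tau>\<^sup>2) *\<^sub>R (X - Y) - ((- (T\<^sup>2) + T + \<tau>\<^sup>2) / (\<tau>\<^sup>2 * T)) *\<^sub>R X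
    = (1 - 1 / T) *\<^sub>R X + ((T - 1) / \<tau>\<^sup>2) *\<^sub>R (Y + \<tau> *\<^sub>R (X - Y))"
proof -
  define \<alpha> where "\<alpha> = (T - 1) * (\<tau> - 1) / \<tau>\<^sup>2"
  define \<gamma> where "\<gamma> = (- (T\<^sup>2) + T + \<tau>\<^sup>2) / (\<tau>\<^sup>2 * T)"
  define \<beta> where "\<beta> = (T - 1) / \<tau>\<^sup>2"
  have "1 + \<alpha> - \<gamma> = (1 - 1 / T) + \<beta> * \<tau>"
    using assms by (simp add: \<alpha>_def \<beta>_def \<gamma>_def field_simps power2_eq_square)
  moreover have "- \<alpha> = \<beta> - \<beta> * \<tau>"
    using assms by (simp add: \<alpha>_def \<beta>_def field_simps power2_eq_square)
  moreover have "X + \<alpha> *\<^sub>R (X - Y) - \<gamma> *\<^sub>R X = (1 + \<alpha> - \<gamma>) *\<^sub>R X + (- \<alpha>) *\<^sub>R Y"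
    by (simp add: algebra_simps)
  moreover have "(1 - 1 / T) *\<^sub>R X + \<beta> *\<^sub>R (Y + \<tau> *\<^sub>R (X - Y))
      = ((1 - 1 / T) + \<beta> * \<tau>) *\<^sub>R X + (\<beta> - \<beta> * \<tau>) *\<^sub>R Y"
    by (simp add: algebra_simps)
  ultimately show ?thesis by (simp add: \<alpha>_def \<beta>_def \<gamma>_def)
qed

theorem theorem1:
  fixes f :: "'a::{real_inner, complete_space} \<Rightarrow> ereal"
    and g :: "'a \<Rightarrow> real"
    and grad_g :: "'a \<Rightarrow> 'a"
    and L s q a c p :: real
    and \<epsilon> :: "nat \<Rightarrow> real"
    and x y :: "nat \<Rightarrow> 'a"
  assumes "proper_fun f" and "convex_fun f" and "lsc_fun f"
    and "convex_on UNIV g"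
    and "\<And>z. GDERIV g z :> grad_g z"
    and "continuous_on UNIV grad_g"
    and "L > 0" and "L-lipschitz_on UNIV grad_g"
    and "argmin_set (fsum f g) \<noteq> {}"
    and "0 < s" and "s < 1 / L"
    and "1 / 2 \<le> q" and "q \<le> 1"
    and "0 < a" and "a \<le> 1 / (2 * q)"
    and "c > 0" and "p > 0"
    and "\<And>k. k \<ge> 1 \<Longrightarrow> \<epsilon> k = c / real k powr p"
    and "\<And>k. k \<ge> 1 \<Longrightarrow>
      y k = x k
        + ((((a * real k + 1) powr q - 1) * ((a * real k + 1 - a) powr q - 1))
            / (a * real k + 1 - a) powr (2 * q)) *\<^sub>R (x k - x (k - 1))
        - ((- ((a * real k + 1) powr (2 * q)) + (a * real k + 1) powr q
              + (a * real k + 1 - a) powr (2 * q))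
            / ((a * real k + 1 - a) powr (2 * q) * (a * real k + 1) powr q)) *\<^sub>R x k"
    and "\<And>k. k \<ge> 1 \<Longrightarrow>
      x (k + 1) = prox s f (y k - s *\<^sub>R grad_g (y k) - (s * (c / real k powr p)) *\<^sub>R y k)"
  shows
    "(q < 1 \<and> p < 2 * q \<longrightarrow>
        (\<exists>xstar. {xstar} = metric_proj (argmin_set (fsum f g)) 0
           \<and> x \<longlonglongrightarrow> xstar
           \<and> (\<lambda>k. norm (x k - y k)) \<in> o(\<lambda>k. sqrt (\<epsilon> k))
           \<and> y \<longlonglongrightarrow> xstar)
        \<and> gap_bigo (fsum f g) x (\<lambda>k. real k powr (- p))
        \<and> (\<lambda>k. norm (x k - x (k - 1))) \<in> o(\<lambda>k. real k powr (- p / 2))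
        \<and> (\<exists>u. (\<forall>k\<ge>2. u k \<in> (\<lambda>v. v + grad_g (x k)) ` subdiff f (x k))
              \<and> (\<lambda>k. norm (u k)) \<in> o(\<lambda>k. real k powr (- p / 2))))
     \<and> (p \<ge> 2 * q \<and> (a = 1 / 2 \<and> q = 1 \<longrightarrow> p > 2) \<longrightarrow>
          gap_bigo (fsum f g) x (\<lambda>k. real k powr (- (2 * q))))"
proof -

  \<comment> \<open>Reduction to real-valued functions on the effective domain\<close>
  note prop_f = assms(1) and convex_f = assms(2) and lsc_f = assms(3)
    and L_pos = assms(7) and s_pos = assms(10) and s_L = assms(11)
    and y_def = assms(19) and x_def = assms(20)
  interpret P: step_parameters a q c p
    by standard (use assms in auto)
  define D where "D = {z. f z \<noteq> \<infinity>}"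
  define \<phi> where "\<phi> z = real_of_ereal (f z)" for z
  have f_eq: "f z = ereal (\<phi> z)" if "z \<in> D" for z
    using proper_fun_ereal[OF prop_f] that by (simp add: D_def \<phi>_def)
  have h_eq: "fsum f g z = ereal (\<phi> z + g z)" if "z \<in> D" for z
    using f_eq[OF that] by (simp add: fsum_def)
  have h_inf: "fsum f g z = \<infinity>" if "z \<notin> D" for z
    using that by (simp add: fsum_def D_def)
  obtain xm where xm: "xm \<in> argmin_set (fsum f g)" using assms(9) by blast
  have xm_le: "fsum f g xm \<le> fsum f g z" for z
    using xm by (auto simp: argmin_set_def is_arg_min_def not_less)
  obtain z0 where "z0 \<in> D" using prop_f by (auto simp: proper_fun_def D_def)
  \<comment> \<open>Properness supplies a point of finite value, so the minimum is finite.\<close>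
  then have xm_D: "xm \<in> D"
    using xm_le[of z0] h_eq[of z0] h_inf[of xm] by force
  have xm_min: "\<phi> xm + g xm \<le> \<phi> z + g z" if "z \<in> D" for z
    using xm_le[of z] unfolding h_eq[OF that] h_eq[OF xm_D] by simp
  have closed_phi: "closed {v \<in> D. \<phi> v \<le> b}" for b
    using proper_sublevel_real[OF prop_f, of b] lsc_fun_closed_sublevel[OF lsc_f]
    by (simp add: D_def \<phi>_def)
  interpret C: composite_problem D \<phi> g grad_g L xm
  proof
    show "convex_on D \<phi>"
      using convex_fun_imp_convex_on[OF prop_f convex_f] unfolding D_def \<phi>_def[abs_def] .
  qed (use assms closed_phi xm_D xm_min in auto)

  \<comment> \<open>The proximal map and the iteration\<close>
  have prox_D: "prox s f u \<in> D"
    and prox_sub: "w \<in> D \<Longrightarrow>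
      \<phi> (prox s f u) + inner ((1 / s) *\<^sub>R (u - prox s f u)) (w - prox s f u) \<le> \<phi> w" for u w
  proof -
    obtain p' where p': "p' \<in> D" "\<And>z. z \<in> D \<Longrightarrow>
        \<phi> p' + 1 / (2 * s) * (norm (p' - u))\<^sup>2 \<le> \<phi> z + 1 / (2 * s) * (norm (z - u))\<^sup>2"
      using C.prox_exists[OF s_pos] by blast
    have p'': "f p' \<noteq> \<infinity>" "\<And>z. f z \<noteq> \<infinity> \<Longrightarrow> real_of_ereal (f p') + 1 / (2 * s) * (norm (p' - u))\<^sup>2
        \<le> real_of_ereal (f z) + 1 / (2 * s) * (norm (z - u))\<^sup>2"
      using p' by (auto simp: D_def \<phi>_def)
    show *: "prox s f u \<in> D"
      using prox_minimizes(1)[OF prop_f p''] by (simp add: D_def)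
    show "\<phi> (prox s f u) + inner ((1 / s) *\<^sub>R (u - prox s f u)) (w - prox s f u) \<le> \<phi> w" if "w \<in> D"
      by (rule C.prox_subgradient[OF s_pos * _ that])
        (use prox_minimizes(2)[OF prop_f p''] in \<open>simp add: D_def \<phi>_def\<close>)
  qed
  define pt where "pt k = y k - s *\<^sub>R grad_g (y k) - (s * P.eps k) *\<^sub>R y k" for k
  have x_prox: "x (Suc k) = prox s f (pt k)" if "1 \<le> k" for k
    using x_def[OF that] by (simp add: pt_def P.eps_def)
  have T_sq: "(a * real k + 1) powr (2 * q) = (P.t (Suc k))\<^sup>2"
    and t_sq: "(a * real k + 1 - a) powr (2 * q) = (P.t k)\<^sup>2" for k
    unfolding P.t_Suc unfolding P.t_def by (simp_all add: power2_eq_square flip: powr_add)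
  define \<alpha> where "\<alpha> k = (P.t (Suc k) - 1) * (P.t k - 1) / (P.t k)\<^sup>2" for k
  define \<gamma> where "\<gamma> k = (- ((P.t (Suc k))\<^sup>2) + P.t (Suc k) + (P.t k)\<^sup>2) / ((P.t k)\<^sup>2 * P.t (Suc k))" for k
  have y_eq: "y k = x k + \<alpha> k *\<^sub>R (x k - x (k - 1)) - \<gamma> k *\<^sub>R x k" if "1 \<le> k" for k
    unfolding y_def[OF that] T_sq t_sq \<alpha>_def \<gamma>_def P.t_Suc by (simp add: P.t_def)
  interpret I: inertial_tikhonov D \<phi> g grad_g L xm s P.eps P.t x y
  proof
    show "s * L < 1" using s_L L_pos by (simp add: field_simps)
    fix k :: nat assume k: "1 \<le> k"
    show "y k = (1 - 1 / P.t (Suc k)) *\<^sub>R x k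
        + ((P.t (Suc k) - 1) / (P.t k)\<^sup>2) *\<^sub>R (x (k - 1) + P.t k *\<^sub>R (x k - x (k - 1)))"
    proof -
      have "P.t (Suc k) \<noteq> 0" "P.t k \<noteq> 0" using P.t_ge[of "Suc k"] P.t_ge[OF k] by auto
      from inertial_extrapolation_eq[OF this, of "x k" "x (k - 1)"] y_eq[OF k]
      show ?thesis unfolding \<alpha>_def \<gamma>_def by simp
    qed
    show "x (Suc k) \<in> D" using x_prox[OF k] prox_D by simp
    fix w assume w: "w \<in> D"
    show "\<phi> (x (Suc k)) + inner ((1 / s) *\<^sub>R (y k - s *\<^sub>R grad_g (y k) - (s * P.eps k) *\<^sub>R y k - x (Suc k)))
        (w - x (Suc k)) \<le> \<phi> w"
      using prox_sub[OF w, of "pt k"] unfolding x_prox[OF k, symmetric] unfolding pt_def .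
  qed (use s_pos P.eps_pos P.eps_dec P.eps_lim P.t_ge P.t_mono P.t_growth in auto)

  \<comment> \<open>Minimizers, minimal value and gap of the extended-real-valued objective\<close>
  have argmin_eq: "argmin_set (fsum f g) = {z \<in> D. C.F z = C.F xm}"
  proof (intro set_eqI iffI)
    fix z assume "z \<in> argmin_set (fsum f g)"
    then have le: "fsum f g z \<le> fsum f g xm"
      by (auto simp: argmin_set_def is_arg_min_def not_less)
    then have z: "z \<in> D" using h_inf[of z] h_eq[OF xm_D] by (cases "z \<in> D") auto
    with le show "z \<in> {z \<in> D. C.F z = C.F xm}"
      using h_eq[OF z] h_eq[OF xm_D] C.F_ge_min[OF z] by (auto simp: C.F_def)
  next
    fix z assume "z \<in> {z \<in> D. C.F z = C.F xm}"
    then have "fsum f g z = fsum f g xm"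
      using h_eq[of z] h_eq[OF xm_D] by (simp add: C.F_def)
    then show "z \<in> argmin_set (fsum f g)"
      using xm_le by (auto simp: argmin_set_def is_arg_min_def not_less)
  qed
  have inf_eq: "(INF z. fsum f g z) = ereal (C.F xm)"
  proof (rule antisym)
    show "(INF z. fsum f g z) \<le> ereal (C.F xm)"
      using INF_lower[of xm UNIV "fsum f g"] h_eq[OF xm_D] by (simp add: C.F_def)
    show "ereal (C.F xm) \<le> (INF z. fsum f g z)"
      using xm_le h_eq[OF xm_D] by (intro INF_greatest) (simp add: C.F_def)
  qed
  have gap: "gap_bigo (fsum f g) x r" if r: "(\<lambda>k. C.F (x k) - C.F xm) \<in> O(r)" for r
    unfolding gap_bigo_def
  proof
    show "\<forall>\<^sub>F k in sequentially. \<bar>fsum f g (x k)\<bar> \<noteq> \<infinity>"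
      using eventually_ge_at_top[of 2] by eventually_elim (simp add: h_eq I.x_in_D)
    have "\<forall>\<^sub>F k in sequentially.
        real_of_ereal (fsum f g (x k) - (INF z. fsum f g z)) = C.F (x k) - C.F xm"
      using eventually_ge_at_top[of 2]
      by eventually_elim (simp add: h_eq I.x_in_D inf_eq C.F_def)
    from landau_o.big.in_cong[OF this] r
    show "(\<lambda>k. real_of_ereal (fsum f g (x k) - (INF z. fsum f g z))) \<in> O(r)" by simp
  qed

  \<comment> \<open>Objective rate for \<open>p \<ge> 2 * q\<close>\<close>
  have part2: "gap_bigo (fsum f g) x (\<lambda>k. real k powr (- (2 * q)))"
    if p2: "2 * q \<le> p" and crit: "a = 1 / 2 \<and> q = 1 \<longrightarrow> 2 < p"
  proof -
    have "\<exists>K. \<forall>\<^sub>F k in sequentially. I.E xm k \<le> K"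
    proof (cases "a = 1 / 2 \<and> q = 1")
      case True
      then have "2 < p" "a = 1 / 2" "q = 1" using crit by auto
      from P.critical_summable[OF this] show ?thesis
        unfolding I.\<theta>_def[symmetric] by (rule I.energy_bounded_summable[OF xm_D])
    next
      case False
      then obtain B where "\<forall>\<^sub>F k in sequentially. (P.t (Suc k))\<^sup>2 * (P.eps (k - 1) - P.eps k)
          \<le> B * (1 - I.\<theta> k)"
        using P.perturbation_le_contraction[OF p2] unfolding I.\<theta>_def by blast
      then show ?thesis by (rule I.energy_bounded_contraction[OF xm_D])
    qed
    then obtain K where K: "\<forall>\<^sub>F k in sequentially. I.E xm k \<le> K" by blast
    \<comment> \<open>As \<open>p \<ge> 2 * q\<close>, the regularization weight contributes no more
      to the gap than \<open>1 / (t k)\<^sup>2\<close> does.\<close>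
    have "(\<lambda>k. P.eps (k - 1)) \<in> O(\<lambda>k. real k powr (- (2 * q)))"
      by (rule landau_o.big_trans[OF P.eps_pred_bigo P.powr_bigo_mono]) (use p2 in simp)
    from I.gap_bigo_energy[OF K this P.inverse_t_sq_bigo C.F_ge_min]
    show ?thesis by (rule gap)
  qed

  \<comment> \<open>Strong convergence and rates for \<open>q < 1\<close> and
    \<open>p < 2 * q\<close>\<close>
  have part1: "(\<exists>xstar. {xstar} = metric_proj (argmin_set (fsum f g)) 0
           \<and> x \<longlonglongrightarrow> xstar
           \<and> (\<lambda>k. norm (x k - y k)) \<in> o(\<lambda>k. sqrt (\<epsilon> k))
           \<and> y \<longlonglongrightarrow> xstar)
        \<and> gap_bigo (fsum f g) x (\<lambda>k. real k powr (- p))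
        \<and> (\<lambda>k. norm (x k - x (k - 1))) \<in> o(\<lambda>k. real k powr (- p / 2))
        \<and> (\<exists>u. (\<forall>k\<ge>2. u k \<in> (\<lambda>v. v + grad_g (x k)) ` subdiff f (x k))
              \<and> (\<lambda>k. norm (u k)) \<in> o(\<lambda>k. real k powr (- p / 2)))"
    if q1: "q < 1" and p2: "p < 2 * q"
  proof -
    obtain v where v: "v \<in> D" "C.F v = C.F xm"
      and v_min: "\<And>w. w \<in> D \<Longrightarrow> C.F w = C.F xm \<Longrightarrow> norm v \<le> norm w"
      and v_unique: "\<And>w. w \<in> D \<Longrightarrow> C.F w = C.F xm \<Longrightarrow> norm w \<le> norm v \<Longrightarrow> w = v"
      and x_lim: "x \<longlonglongrightarrow> v"
      and vel: "(\<lambda>k. (norm (x k - x (k - 1)))\<^sup>2 / P.eps (k - 1)) \<longlonglongrightarrow> 0"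
      and gap_le: "\<forall>\<^sub>F k in sequentially. C.F (x k) - C.F xm \<le> ((norm v)\<^sup>2 + 1) * P.eps (k - 1)"
      using I.strong_convergence[OF P.rate_lim[OF q1] P.t_sq_eps_lim[OF p2]] by blast
    \<comment> \<open>The common scale of the rates: \<open>sqrt (\<epsilon> k)\<close> is
      \<open>sqrt c * r k\<close> for \<open>k \<ge> 1\<close>.\<close>
    define r where "r k = real k powr (- p / 2)" for k
    have r_pos: "0 < r k" if "1 \<le> k" for k using that by (simp add: r_def)
    have r_nz: "\<forall>\<^sub>F k in sequentially. r k \<noteq> 0"
      using eventually_ge_at_top[of 1] by eventually_elim (use r_pos in force)
    have r_sq: "(r k)\<^sup>2 = real k powr (- p)" for k
      by (simp add: r_def power2_eq_square flip: powr_add)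

    have proj: "{v} = metric_proj (argmin_set (fsum f g)) 0"
      unfolding metric_proj_def argmin_eq using v v_min v_unique by (auto simp: dist_norm)

    \<comment> \<open>The velocity limit is shifted to \<open>Suc k\<close>, and its weight
      \<open>P.eps k\<close> is exchanged for \<open>real (Suc k) powr (- p)\<close>, the ratio of
      the two tending to \<open>c\<close>.\<close>
    have "(\<lambda>k. (norm (x (Suc k) - x k))\<^sup>2 / P.eps k) \<longlonglongrightarrow> 0"
      using LIMSEQ_Suc[OF vel] by simp
    from tendsto_mult[OF this P.eps_shift_lims(1)]
    have "(\<lambda>k. (norm (x (Suc k) - x k))\<^sup>2 / P.eps k * (P.eps k / real (Suc k) powr (- p))) \<longlonglongrightarrow> 0"
      by simp
    moreover have "\<forall>\<^sub>F k in sequentially.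
        (norm (x (Suc k) - x k))\<^sup>2 / P.eps k * (P.eps k / real (Suc k) powr (- p))
          = (norm (x (Suc k) - x k) / r (Suc k))\<^sup>2"
      using eventually_ge_at_top[of 1]
    proof eventually_elim
      case (elim k)
      show ?case using P.eps_pos[OF elim] unfolding power_divide r_sq by simp
    qed
    ultimately have "(\<lambda>k. (norm (x (Suc k) - x k) / r (Suc k))\<^sup>2) \<longlonglongrightarrow> 0"
      by (rule Lim_transform_eventually)
    then have vel_Suc: "(\<lambda>k. norm (x (Suc k) - x k) / r (Suc k)) \<longlonglongrightarrow> 0"
      using tendsto_real_sqrt by (force simp: tendsto_rabs_zero_iff)
    have vel_r: "(\<lambda>k. norm (x k - x (k - 1)) / r k) \<longlonglongrightarrow> 0"
      by (rule LIMSEQ_imp_Suc) (use vel_Suc in simp)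
    have vel_o: "(\<lambda>k. norm (x k - x (k - 1))) \<in> o(r)"
      by (rule smalloI_tendsto[OF vel_r r_nz])

    have xy_r: "(\<lambda>k. norm (x k - y k) / r k) \<longlonglongrightarrow> 0"
    proof (rule tendsto_sandwich[OF _ _ tendsto_const])
      \<comment> \<open>The inertial coefficient tends to 1 and multiplies a velocity of order
        \<open>o(r)\<close>; the shrinkage coefficient is itself \<open>o(r)\<close> and multiplies
        the convergent \<open>x k\<close>.\<close>
      have "(\<lambda>k. \<bar>\<alpha> k\<bar> * (norm (x k - x (k - 1)) / r k) + \<bar>\<gamma> k\<bar> / r k * norm (x k)) \<longlonglongrightarrow> \<bar>1\<bar> * 0 + 0 * norm v"
        unfolding \<alpha>_def \<gamma>_def r_def
        by (intro tendsto_intros P.inertia_lim P.shrinkage_lim[OF p2] x_lim vel_r[unfolded r_def])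
      then show "(\<lambda>k. \<bar>\<alpha> k\<bar> * (norm (x k - x (k - 1)) / r k) + \<bar>\<gamma> k\<bar> / r k * norm (x k)) \<longlonglongrightarrow> 0" by simp
      show "\<forall>\<^sub>F k in sequentially. norm (x k - y k) / r k
          \<le> \<bar>\<alpha> k\<bar> * (norm (x k - x (k - 1)) / r k) + \<bar>\<gamma> k\<bar> / r k * norm (x k)"
        using eventually_ge_at_top[of 1]
      proof eventually_elim
        case (elim k)
        have "x k - y k = \<gamma> k *\<^sub>R x k - \<alpha> k *\<^sub>R (x k - x (k - 1))"
          using y_eq[OF elim] by simp
        then have "norm (x k - y k) \<le> \<bar>\<alpha> k\<bar> * norm (x k - x (k - 1)) + \<bar>\<gamma> k\<bar> * norm (x k)"
          using norm_triangle_ineq4[of "\<gamma> k *\<^sub>R x k" "\<alpha> k *\<^sub>R (x k - x (k - 1))"] by simp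
        then have "norm (x k - y k) / r k \<le> (\<bar>\<alpha> k\<bar> * norm (x k - x (k - 1)) + \<bar>\<gamma> k\<bar> * norm (x k)) / r k"
          using r_pos[OF elim] by (intro divide_right_mono) auto
        then show ?case by (simp add: add_divide_distrib)
      qed
    qed (simp add: r_def)
    have "(\<lambda>k. norm (x k - y k)) \<in> o(\<lambda>k. sqrt c * r k)"
      using smalloI_tendsto[OF xy_r r_nz] assms(16) by simp
    moreover have ev_eps: "\<forall>\<^sub>F k in sequentially. sqrt (\<epsilon> k) = sqrt c * r k"
      using eventually_ge_at_top[of 1]
    proof eventually_elim
      case (elim k)
      have "\<epsilon> k = c * (r k)\<^sup>2"
        using assms(18)[OF elim] by (simp add: r_sq powr_minus_divide)
      then show ?case using r_pos[OF elim] by (simp add: real_sqrt_mult)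
    qed
    ultimately have xy_o: "(\<lambda>k. norm (x k - y k)) \<in> o(\<lambda>k. sqrt (\<epsilon> k))"
      using landau_o.small.cong[OF ev_eps] by simp

    have "r \<longlonglongrightarrow> 0" unfolding r_def using assms(17) by real_asymp
    from tendsto_mult[OF xy_r this] have "(\<lambda>k. norm (x k - y k) / r k * r k) \<longlonglongrightarrow> 0" by simp
    moreover have "\<forall>\<^sub>F k in sequentially. norm (x k - y k) / r k * r k = norm (x k - y k)"
      using r_nz by eventually_elim simp
    ultimately have "(\<lambda>k. norm (x k - y k)) \<longlonglongrightarrow> 0"
      by (rule Lim_transform_eventually)
    then have "(\<lambda>k. x k - (x k - y k)) \<longlonglongrightarrow> v - 0"
      by (intro tendsto_diff x_lim) (simp only: tendsto_norm_zero_iff)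
    then have y_lim: "y \<longlonglongrightarrow> v" by simp

    have "(\<lambda>k. C.F (x k) - C.F xm) \<in> O(\<lambda>k. P.eps (k - 1))"
    proof (rule landau_o.bigI)
      show "0 < (norm v)\<^sup>2 + 1" by (simp add: add_nonneg_pos)
      show "\<forall>\<^sub>F k in sequentially.
          norm (C.F (x k) - C.F xm) \<le> ((norm v)\<^sup>2 + 1) * norm (P.eps (k - 1))"
        using gap_le eventually_ge_at_top[of 2]
      proof eventually_elim
        case (elim k)
        have "1 \<le> k - 1" using elim(2) by linarith
        from P.eps_pos[OF this] C.F_ge_min[OF I.x_in_D[OF elim(2)]] elim(1)
        show ?case by simp
      qed
    qed
    from gap[OF landau_o.big_trans[OF this P.eps_pred_bigo]]
    have gap1: "gap_bigo (fsum f g) x (\<lambda>k. real k powr (- p))" .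

    \<comment> \<open>Optimality of the proximal step taken at \<open>pt (k - 1)\<close> puts the
      first summand into \<open>subdiff f (x k)\<close>.\<close>
    define u where "u k = (1 / s) *\<^sub>R (pt (k - 1) - x k) + grad_g (x k)" for k
    have u_mem: "u k \<in> (\<lambda>v. v + grad_g (x k)) ` subdiff f (x k)" if k: "2 \<le> k" for k
    proof -
      have "1 \<le> k - 1" "Suc (k - 1) = k" using k by auto
      then have xk: "x k = prox s f (pt (k - 1))" using x_prox[of "k - 1"] by simp
      have xkD: "x k \<in> D" by (rule I.x_in_D[OF k])
      have "f (x k) + ereal (inner ((1 / s) *\<^sub>R (pt (k - 1) - x k)) (w - x k)) \<le> f w" for w
      proof (cases "w \<in> D")
        case True
        then show ?thesis
          using prox_sub[OF True, of "pt (k - 1)"] f_eq[OF True] f_eq[OF xkD]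
          unfolding xk[symmetric] by simp
      next
        case False
        then show ?thesis by (simp add: D_def)
      qed
      then have "(1 / s) *\<^sub>R (pt (k - 1) - x k) \<in> subdiff f (x k)"
        using f_eq[OF xkD] by (simp add: subdiff_def)
      then show ?thesis unfolding u_def by (rule imageI)
    qed
    have u_Suc: "(\<lambda>k. norm (u (Suc k)) / r (Suc k)) \<longlonglongrightarrow> 0"
    proof (rule tendsto_sandwich[OF _ _ tendsto_const])
      define bd where "bd k = (1 / s + L) * (norm (x (Suc k) - x k) / r (Suc k)
          + norm (x k - y k) / r k * (r k / r (Suc k))) + P.eps k / r (Suc k) * norm (y k)" for k
      have "bd \<longlonglongrightarrow> (1 / s + L) * (0 + 0 * 1) + 0 * norm v"
        unfolding bd_def
        by (intro tendsto_intros vel_Suc xy_r y_lim P.eps_shift_lims[folded r_def])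
      then show "bd \<longlonglongrightarrow> 0" by simp
      show "\<forall>\<^sub>F k in sequentially. norm (u (Suc k)) / r (Suc k) \<le> bd k"
        using eventually_ge_at_top[of 1]
      proof eventually_elim
        case (elim k)
        have ek: "0 < P.eps k" by (rule P.eps_pos[OF elim])
        \<comment> \<open>Inserting \<open>pt k\<close> leaves the displacement, a gradient
          difference controlled by \<open>L\<close>, and the regularization term, which is
          negligible because \<open>P.eps k / r (Suc k)\<close> tends to 0.\<close>
        have "u (Suc k) = (1 / s) *\<^sub>R (y k - x (Suc k)) + (grad_g (x (Suc k)) - grad_g (y k)) - P.eps k *\<^sub>R y k"
          using s_pos by (simp add: u_def pt_def scaleR_diff_right)
        also have "norm \<dots> \<le> norm ((1 / s) *\<^sub>R (y k - x (Suc k))) + norm (grad_g (x (Suc k)) - grad_g (y k))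
            + norm (P.eps k *\<^sub>R y k)"
          by (intro order_trans[OF norm_triangle_ineq4] add_right_mono norm_triangle_ineq)
        also have "\<dots> \<le> 1 / s * norm (x (Suc k) - y k) + L * norm (x (Suc k) - y k) + P.eps k * norm (y k)"
          using lipschitz_onD[OF assms(8), of "x (Suc k)" "y k"] s_pos ek
          by (simp add: dist_norm norm_minus_commute)
        also have "\<dots> = (1 / s + L) * norm (x (Suc k) - y k) + P.eps k * norm (y k)"
          by (simp add: distrib_right)
        also have "\<dots> \<le> (1 / s + L) * (norm (x (Suc k) - x k) + norm (x k - y k)) + P.eps k * norm (y k)"
          using norm_triangle_ineq[of "x (Suc k) - x k" "x k - y k"] s_pos L_pos
          by (intro add_right_mono mult_left_mono) auto
        finally have "norm (u (Suc k)) / r (Suc k)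
            \<le> ((1 / s + L) * (norm (x (Suc k) - x k) + norm (x k - y k)) + P.eps k * norm (y k)) / r (Suc k)"
          using r_pos[of "Suc k"] by (intro divide_right_mono) auto
        also have "\<dots> = bd k"
          using r_pos[OF elim] by (simp add: bd_def add_divide_distrib distrib_left)
        finally show ?case .
      qed
    qed (simp add: r_def)
    have "(\<lambda>k. norm (u k) / r k) \<longlonglongrightarrow> 0"
      by (rule LIMSEQ_imp_Suc[OF u_Suc])
    then have u_o: "(\<lambda>k. norm (u k)) \<in> o(r)"
      by (rule smalloI_tendsto[OF _ r_nz])
    show ?thesis
      using proj x_lim xy_o y_lim gap1 vel_o u_mem u_o unfolding r_def by blast
  qed
  show ?thesis using part1 part2 by blast
qed

end
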